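(* (Relativistic Carleman representation) For nonnegative $f$ on $\mathbb{R}^3$, the relativistic gain operator $$Q^+(f,f)(p)=\frac1{p^0}\int_{\mathbb{R}^3}\frac{dq}{q^0}\int_{\mathbb{R}^3}\frac{dq'}{q'^0}\int_{\mathbb{R}^3}\frac{dp'}{p'^0}\,\frac12 s\,\sigma(g,\theta)\,\delta^{(4)}(p^\mu+q^\mu-p'^\mu-q'^\mu)f(p')f(q')$$ has the following alternative representation: $$Q^+(f,f)(p)=\frac1{4p^0}\int_{\mathbb{R}^3}\frac{dp'}{p'^0}\,f(p')\int_{(p'^\mu-p^\mu)(q'_\mu-p_\mu)=0}\frac{d\pi_{q'}}{q'^0}\;\frac{s\,\sigma\,u(p'^0+q'^0-p^0)\,f(q')}{\left|(p'^0-p^0)\frac{q'}{q'^0}-(p'-p)\right|},$$ where $u(x)=1$ for $x>0$ and $u(x)=0$ for $x\le0$, and $d\pi_{q'}$ is the surface measure on the relativistic hypersurface of energy-momentum vectors $q'^\mu=(q'^0,q')$, $q'\in\mathbb{R}^3$, $q'^0=\sqrt{1+|q'|^2}$, satisfying $(p'^\mu-p^\mu)(q'_\mu-p_\mu)=0$.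
   Context: Notation. For $p\in\mathbb{R}^3$ let $p^0=\sqrt{1+|p|^2}$ and $p^\mu=(p^0,p)$, and similarly for $q,p',q'$. The Lorentz product of 4-vectors is $a^\mu b_\mu=-a^0b^0+\sum_{i=1}^3a^ib^i$. Put $s=s(p^\mu,q^\mu)=2(-p^\mu q_\mu+1)$ and $g=g(p^\mu,q^\mu)=\sqrt{(p^\mu-q^\mu)(p_\mu-q_\mu)}$. When $p^\mu+q^\mu=p'^\mu+q'^\mu$ one has $s(p^\mu,q^\mu)=s(p'^\mu,q'^\mu)$ and $g(p^\mu,q^\mu)=g(p'^\mu,q'^\mu)$. The scattering angle is given by $\cos\theta=(p^\mu-q^\mu)(p'_\mu-q'_\mu)/g^2$. The scattering kernel $\sigma=\sigma(g,\theta)\ge0$ is a given function, and $\delta^{(4)}$ is the four-dimensional Dirac delta. In the Carleman representation $s$, $g$, $\theta$ are evaluated with $q^\mu=p'^\mu+q'^\mu-p^\mu$.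
   Formalization: The prefactor of the alternative representation is 1/(2p^0) instead of the printed 1/(4p^0), which is off by a factor 2 whenever both sides are finite and nonzero (e.g. σ=1, f a continuous bump); f and σ are taken Borel measurable. *)

theory Defs
  imports "HOL-Analysis.Analysis"
begin

section \<open>Relativistic kinematics\<close>

text \<open>A 4-vector \<open>(a\<^sup>0, a)\<close> is an element of \<^typ>\<open>real \<times> (real ^ 3)\<close>.\<close>

definition energy :: "real ^ 3 \<Rightarrow> real" where
  "energy p = sqrt (1 + (norm p)\<^sup>2)"

definition four_mom :: "real ^ 3 \<Rightarrow> real \<times> (real ^ 3)" where
  "four_mom p = (energy p, p)"

definition lorentz :: "real \<times> (real ^ 3) \<Rightarrow> real \<times> (real ^ 3) \<Rightarrow> real" where
  "lorentz a b = - (fst a * fst b) + snd a \<bullet> snd b"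

definition s_inv :: "real \<times> (real ^ 3) \<Rightarrow> real \<times> (real ^ 3) \<Rightarrow> real" where
  "s_inv P Q = 2 * (- lorentz P Q + 1)"

definition g_inv :: "real \<times> (real ^ 3) \<Rightarrow> real \<times> (real ^ 3) \<Rightarrow> real" where
  "g_inv P Q = sqrt (lorentz (P - Q) (P - Q))"

definition scat_angle ::
    "real \<times> (real ^ 3) \<Rightarrow> real \<times> (real ^ 3) \<Rightarrow> real \<times> (real ^ 3) \<Rightarrow> real \<times> (real ^ 3) \<Rightarrow> real" where
  "scat_angle P Q P' Q' = arccos (lorentz (P - Q) (P' - Q') / (g_inv P Q)\<^sup>2)"

definition unit_step :: "real \<Rightarrow> real" where
  "unit_step x = (if x > 0 then 1 else 0)"


section \<open>The Dirac delta of a map\<close>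

text \<open>
  For a continuous map \<open>\<Phi>\<close>, the expression \<open>\<delta>(\<Phi>(x)) dx\<close> denotes the locally finite Borel measure
  that is the vague limit of \<open>\<epsilon>\<^sup>-\<^sup>n \<eta>(\<Phi>(x) / \<epsilon>) dx\<close> for every mollifier \<open>\<eta>\<close> on the
  \<open>n\<close>-dimensional target space. A locally finite Borel measure is determined by its integrals
  of continuous compactly supported functions, so there is at most one such measure. Being a measure,
  it can be integrated against arbitrary nonnegative Borel functions.
\<close>

definition test_fun :: "('a::euclidean_space \<Rightarrow> real) \<Rightarrow> bool" where
  "test_fun \<psi> \<longleftrightarrow> continuous_on UNIV \<psi> \<and> bounded {x. \<psi> x \<noteq> 0}"

definition mollifier :: "('b::euclidean_space \<Rightarrow> real) \<Rightarrow> bool" where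
  "mollifier \<eta> \<longleftrightarrow> test_fun \<eta> \<and> (\<forall>y. 0 \<le> \<eta> y) \<and> (\<integral>y. \<eta> y \<partial>lborel) = 1"

definition is_dirac_delta ::
    "('a::euclidean_space \<Rightarrow> 'b::euclidean_space) \<Rightarrow> 'a measure \<Rightarrow> bool" where
  "is_dirac_delta \<Phi> \<mu> \<longleftrightarrow>
     sets \<mu> = sets borel \<and>
     (\<forall>K. compact K \<longrightarrow> emeasure \<mu> K < \<infinity>) \<and>
     (\<forall>\<eta> \<psi>. mollifier \<eta> \<longrightarrow> test_fun \<psi> \<longrightarrow>
        ((\<lambda>\<epsilon>. \<integral>x. \<psi> x * (\<eta> (\<Phi> x /\<^sub>R \<epsilon>) / \<epsilon> ^ DIM('b)) \<partial>lborel)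
           \<longlongrightarrow> (\<integral>x. \<psi> x \<partial>\<mu>)) (at_right 0))"

definition dirac_delta :: "('a::euclidean_space \<Rightarrow> 'b::euclidean_space) \<Rightarrow> 'a measure" where
  "dirac_delta \<Phi> = (THE \<mu>. is_dirac_delta \<Phi> \<mu>)"


section \<open>Surface measure of a regular surface in three-space\<close>

definition regular_patch ::
    "(real ^ 2) set \<Rightarrow> (real ^ 2 \<Rightarrow> real ^ 3) \<Rightarrow> (real ^ 2 \<Rightarrow> real ^ 2 \<Rightarrow> real ^ 3) \<Rightarrow> bool" where
  "regular_patch U \<phi> \<phi>' \<longleftrightarrow>
     open U \<and> inj_on \<phi> U \<and>
     (\<forall>y\<in>U. (\<phi> has_derivative \<phi>' y) (at y)) \<and>
     (\<forall>i. continuous_on U (\<lambda>y. \<phi>' y (axis i 1))) \<and>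
     (\<forall>y\<in>U. cross3 (\<phi>' y (axis 1 1)) (\<phi>' y (axis 2 1)) \<noteq> 0)"

text \<open>
  The surface measure of \<open>S\<close> is carried by \<open>S\<close> and, in every regular parametrization \<open>\<phi>\<close> of a piece
  of \<open>S\<close>, has the area element \<open>|\<partial>\<^sub>1\<phi> \<times> \<partial>\<^sub>2\<phi>|\<close>. For a closed embedded \<open>C\<^sup>1\<close> surface this
  determines a unique Borel measure on the ambient space.
\<close>

definition is_surface_measure :: "(real ^ 3) set \<Rightarrow> (real ^ 3) measure \<Rightarrow> bool" where
  "is_surface_measure S \<mu> \<longleftrightarrow>
     sets \<mu> = sets borel \<and>
     emeasure \<mu> (- S) = 0 \<and>
     (\<forall>U \<phi> \<phi>' A. regular_patch U \<phi> \<phi>' \<longrightarrow> \<phi> ` U \<subseteq> S \<longrightarrow> A \<in> sets borel \<longrightarrow> A \<subseteq> \<phi> ` U \<longrightarrow>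
        emeasure \<mu> A =
          (\<integral>\<^sup>+ y. ennreal (norm (cross3 (\<phi>' y (axis 1 1)) (\<phi>' y (axis 2 1))))
                  * indicator {y \<in> U. \<phi> y \<in> A} y \<partial>lborel))"

definition surface_measure :: "(real ^ 3) set \<Rightarrow> (real ^ 3) measure" where
  "surface_measure S = (THE \<mu>. is_surface_measure S \<mu>)"


section \<open>The gain operator\<close>

definition momentum_defect :: "real ^ 3 \<Rightarrow> (real ^ 3) \<times> (real ^ 3) \<times> (real ^ 3) \<Rightarrow> real \<times> (real ^ 3)" where
  "momentum_defect p = (\<lambda>(q, q', p'). four_mom p + four_mom q - four_mom p' - four_mom q')"

text \<open>
  The values lie in \<open>[0,\<infinity>]\<close>. The triple integral over \<open>(q, q', p')\<close> is the integral against the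
  single measure \<open>\<delta>\<^sup>(\<^sup>4\<^sup>)(p\<^sup>\<mu> + q\<^sup>\<mu> - p'\<^sup>\<mu> - q'\<^sup>\<mu>) dq dq' dp'\<close> on the product space.
\<close>

definition gain :: "(real \<Rightarrow> real \<Rightarrow> real) \<Rightarrow> (real ^ 3 \<Rightarrow> real) \<Rightarrow> real ^ 3 \<Rightarrow> ennreal" where
  "gain \<sigma> f p =
     ennreal (1 / energy p) *
     (\<integral>\<^sup>+ (q, q', p').
        ennreal (1 / (energy q * energy q' * energy p') *
          (1 / 2 * s_inv (four_mom p) (four_mom q) *
           \<sigma> (g_inv (four_mom p) (four_mom q))
             (scat_angle (four_mom p) (four_mom q) (four_mom p') (four_mom q')) *
           f p' * f q'))
      \<partial>dirac_delta (momentum_defect p))"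

text \<open>
  On the prefactor of the Carleman form. Put \<open>h = (p'\<^sup>\<mu> - p\<^sup>\<mu>)(q'\<^sub>\<mu> - p\<^sub>\<mu>)\<close> and
  \<open>A = p'\<^sup>0 + q'\<^sup>0 - p\<^sup>0\<close>. With \<open>q = p' + q' - p\<close> one has \<open>(q\<^sup>0)\<^sup>2 - A\<^sup>2 = 2 h\<close>, hence
  \<open>\<delta>(q\<^sup>0 - A) / q\<^sup>0 = 2 u(A) \<delta>(2 h) = u(A) \<delta>(h)\<close>. With the kernel \<open>s \<sigma> / 2\<close> the Carleman form
  therefore has prefactor \<open>1 / (2 p\<^sup>0)\<close>. The value \<open>1 / (4 p\<^sup>0)\<close>, which also appears in print,
  does not include the factor 2 of \<open>dq / q\<^sup>0 = 2 u(q\<^sup>0) \<delta>(q\<^sup>\<mu> q\<^sub>\<mu> + 1) d\<^sup>4q\<close>.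
\<close>

end

(* Proof idea. Write q = q' + x and p' = p + x - w. The energy-momentum defect is then
   (E(q' + x) - E(q') - (E(p + x - w) - E(p)), w), so for fixed x and w the delta function lives on
   the level set of the gap E(q' + x) - E(q') at the height h = E(p + x - w) - E(p). In cylindrical
   coordinates q' = (y, t) with axis x the gap is strictly monotone in t with the explicit inverse
   t(h) and Jacobian dt/dh = O(1/|x|) on bounded sets. Replacing (t, w) by the rescaled defect turns
   the mollified integrals into integrals dominated by a multiple of 1/|x| on a bounded set, and
   dominated convergence identifies the delta measure: it has density dt/dh in the coordinates
   (x, y), at h = E(p + x) - E(p). On the other hand (p' - p)(q' - p) = 0 says precisely that q' lies
   on this level set, a global graph over y, whose area element equals
   |(E(p') - E(p)) q'/E(q') - (p' - p)| (dt/dh) / E(q) dy. *)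
theory Submission
  imports Defs
begin

text \<open>The delta measure and the surface measure are both definite descriptions, so each must
  be shown to exist and to be unique before it can be computed. The transfer
  \<open>x = q - q'\<close> is the outer variable because fixing it fixes an axis: the energy gap
  then depends only on \<open>norm x\<close>, \<open>norm y\<close> and \<open>t\<close>, and can be
  inverted in closed form. A mollifier couples all four components of the defect, so the momentum
  part \<open>w\<close> has to be carried along; it moves the level \<open>h\<close> with
  \<epsilon>, and the estimates must be uniform in \<epsilon>. The level at \<epsilon> = 0 is always
  attained, because the energy is 1-Lipschitz with strict inequality while the gap covers exactly
  the open interval from \<open>- norm x\<close> to \<open>norm x\<close>. The degenerate place is
  \<open>x = 0\<close>, that is \<open>p' = p\<close>: there the gap vanishes identically and the
  collision set is all of space. It is a null set for the outer integral, and the singularity of the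
  Jacobian near it is integrable in three dimensions. All identities hold between values in
  [0,\<infinity>], so infinite integrals are covered. On the collision surface the argument of u is
  the energy of \<open>q\<close>, hence positive.\<close>

section \<open>Change of variables for nonnegative functions\<close>

text \<open>A nonnegative Borel function has a gauge integral exactly when its Lebesgue integral is
  finite, so an equivalence for every value \<open>r\<close> also matches the infinite
  cases.\<close>

lemma nn_integral_eq_if_has_integral_iff:
  fixes F :: "'a::euclidean_space \<Rightarrow> real" and D :: "'b::euclidean_space \<Rightarrow> real"
  assumes F: "F \<in> borel_measurable borel" "\<And>x. 0 \<le> F x"
    and D: "D \<in> borel_measurable borel" "\<And>x. 0 \<le> D x"
    and iff: "\<And>r. (F has_integral r) UNIV \<longleftrightarrow> (D has_integral r) UNIV"
  shows "(\<integral>\<^sup>+x. F x \<partial>lborel) = (\<integral>\<^sup>+x. D x \<partial>lborel)"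
proof (cases "\<exists>r. (F has_integral r) UNIV")
  case True
  then obtain r where r: "(F has_integral r) UNIV" by blast
  with iff have "(D has_integral r) UNIV" by blast
  with r show ?thesis
    using nn_integral_has_integral_lborel[OF F] nn_integral_has_integral_lborel[OF D] by metis
next
  case False
  have "(\<integral>\<^sup>+x. F x \<partial>lborel) = \<infinity>"
    using False nn_integral_integrable_on[OF F] by (metis infinity_ennreal_def integrable_on_def less_top)
  moreover have "(\<integral>\<^sup>+x. D x \<partial>lborel) = \<infinity>"
    using False iff nn_integral_integrable_on[OF D] by (metis infinity_ennreal_def integrable_on_def less_top)
  ultimately show ?thesis by simp
qed

lemma nonneg_absolutely_integrable_has_integral_iff:
  fixes f :: "'a::euclidean_space \<Rightarrow> real"
  assumes "\<And>x. x \<in> S \<Longrightarrow> 0 \<le> f x"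
  shows "(f absolutely_integrable_on S \<and> integral S f = r) \<longleftrightarrow>
    ((\<lambda>x. f x * indicator S x) has_integral r) UNIV"
proof -
  have "(f absolutely_integrable_on S \<and> integral S f = r) \<longleftrightarrow> (f has_integral r) S"
    using nonnegative_absolutely_integrable_1[of f S] assms
    by (auto simp: absolutely_integrable_on_def has_integral_iff)
  also have "(f has_integral r) S \<longleftrightarrow> ((\<lambda>x. if x \<in> S then f x else 0) has_integral r) UNIV"
    by (simp add: has_integral_restrict_UNIV)
  also have "(\<lambda>x. if x \<in> S then f x else 0) = (\<lambda>x. f x * indicator S x)"
    by (auto simp: indicator_def)
  finally show ?thesis .
qed

lemma nn_integral_change_of_variables_real:
  fixes f g :: "real \<Rightarrow> real"
  assumes der: "\<And>x. (g has_field_derivative h x) (at x)" and inj: "inj g"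
    and nonneg: "\<And>y. 0 \<le> f y"
    and M: "(\<lambda>y. f y * indicator (range g) y) \<in> borel_measurable borel"
      "(\<lambda>x. \<bar>h x\<bar> * f (g x)) \<in> borel_measurable borel"
  shows "(\<integral>\<^sup>+y. ennreal (f y) * indicator (range g) y \<partial>lborel)
    = (\<integral>\<^sup>+x. ennreal (\<bar>h x\<bar> * f (g x)) \<partial>lborel)"
proof -
  have "(\<integral>\<^sup>+y. ennreal (f y * indicator (range g) y) \<partial>lborel)
    = (\<integral>\<^sup>+x. ennreal (\<bar>h x\<bar> * f (g x)) \<partial>lborel)"
  proof (rule nn_integral_eq_if_has_integral_iff[OF M(1) _ M(2)])
    fix r
    have "(\<lambda>x. \<bar>h x\<bar> *\<^sub>R f (g x)) absolutely_integrable_on UNIV \<and>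
        integral UNIV (\<lambda>x. \<bar>h x\<bar> *\<^sub>R f (g x)) = r
      \<longleftrightarrow> f absolutely_integrable_on range g \<and> integral (range g) f = r"
      by (rule has_absolute_integral_change_of_variables_real) (use der inj in auto)
    then show "((\<lambda>y. f y * indicator (range g) y) has_integral r) UNIV \<longleftrightarrow>
        ((\<lambda>x. \<bar>h x\<bar> * f (g x)) has_integral r) UNIV"
      using nonneg nonneg_absolutely_integrable_has_integral_iff[of "range g" f r]
        nonneg_absolutely_integrable_has_integral_iff[of UNIV "\<lambda>x. \<bar>h x\<bar> * f (g x)" r]
      by simp
  qed (use nonneg in auto)
  then show ?thesis by (simp add: ennreal_mult'' ennreal_indicator nonneg ennreal_mult)
qed

text \<open>Measurability is asked of the two integrands as wholes. For the transition map between
  two patches of a surface both integrands collapse to visibly Borel expressions, whereas the image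
  of \<open>S\<close> and the determinant would need arguments of their own.\<close>

lemma nn_integral_change_of_variables:
  fixes f :: "real ^ 'n::{finite,wellorder} \<Rightarrow> real" and g :: "real ^ 'n::_ \<Rightarrow> real ^ 'n::_"
  assumes S: "S \<in> sets borel"
    and der: "\<And>x. x \<in> S \<Longrightarrow> (g has_derivative g' x) (at x within S)" and inj: "inj_on g S"
    and nonneg: "\<And>y. 0 \<le> f y"
    and M: "(\<lambda>y. f y * indicator (g ` S) y) \<in> borel_measurable borel"
      "(\<lambda>x. \<bar>det (matrix (g' x))\<bar> * f (g x) * indicator S x) \<in> borel_measurable borel"
  shows "(\<integral>\<^sup>+y. ennreal (f y) * indicator (g ` S) y \<partial>lborel)
    = (\<integral>\<^sup>+x. ennreal (\<bar>det (matrix (g' x))\<bar> * f (g x)) * indicator S x \<partial>lborel)"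
proof -
  have "(\<integral>\<^sup>+y. ennreal (f y * indicator (g ` S) y) \<partial>lborel)
    = (\<integral>\<^sup>+x. ennreal (\<bar>det (matrix (g' x))\<bar> * f (g x) * indicator S x) \<partial>lborel)"
  proof (rule nn_integral_eq_if_has_integral_iff[OF M(1) _ M(2)])
    fix r
    \<comment> \<open>The change of variables theorem is about vector-valued functions, so the
      scalar integrand passes through \<open>real ^ 1\<close>.\<close>
    have "(\<lambda>x. \<bar>det (matrix (g' x))\<bar> *\<^sub>R (vec (f (g x)) :: real ^ 1)) absolutely_integrable_on S \<and>
        integral S (\<lambda>x. \<bar>det (matrix (g' x))\<bar> *\<^sub>R (vec (f (g x)) :: real ^ 1)) = vec r
      \<longleftrightarrow> (\<lambda>y. vec (f y) :: real ^ 1) absolutely_integrable_on g ` S \<and>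
        integral (g ` S) (\<lambda>y. vec (f y) :: real ^ 1) = vec r"
      by (rule has_absolute_integral_change_of_variables) (use S der inj in auto)
    then have "(\<lambda>x. \<bar>det (matrix (g' x))\<bar> * f (g x)) absolutely_integrable_on S \<and>
        integral S (\<lambda>x. \<bar>det (matrix (g' x))\<bar> * f (g x)) = r
      \<longleftrightarrow> f absolutely_integrable_on g ` S \<and> integral (g ` S) f = r"
      by (simp add: absolutely_integrable_on_1_iff integral_on_1_eq)
    then show "((\<lambda>y. f y * indicator (g ` S) y) has_integral r) UNIV \<longleftrightarrow>
        ((\<lambda>x. \<bar>det (matrix (g' x))\<bar> * f (g x) * indicator S x) has_integral r) UNIV"
      using nonneg nonneg_absolutely_integrable_has_integral_iff[of "g ` S" f r]
        nonneg_absolutely_integrable_has_integral_iff[of S "\<lambda>x. \<bar>det (matrix (g' x))\<bar> * f (g x)" r]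
      by simp
  qed (use nonneg in auto)
  then show ?thesis by (simp add: ennreal_mult'' ennreal_indicator nonneg ennreal_mult)
qed

section \<open>Orthogonal invariance and product structure of Lebesgue measure\<close>

lemma lborel_distr_orthogonal_transformation:
  fixes f :: "real ^ 'n::{finite,wellorder} \<Rightarrow> real ^ 'n::_"
  assumes f: "orthogonal_transformation f"
  shows "distr lborel borel f = lborel"
proof (rule sym, rule lborel_eqI)
  fix l u :: "real ^ 'n::_" assume lu: "\<And>b. b \<in> Basis \<Longrightarrow> l \<bullet> b \<le> u \<bullet> b"
  have [measurable]: "f \<in> borel_measurable borel"
    using orthogonal_transformation_linear[OF f]
    by (intro borel_measurable_continuous_onI linear_continuous_on)
      (simp add: linear_conv_bounded_linear)
  have bij: "bij f" and g: "orthogonal_transformation (inv f)"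
    using f orthogonal_transformation_bij orthogonal_transformation_inv by auto
  have eq: "f -` box l u = inv f ` box l u"
    using bij by (simp add: bij_vimage_eq_inv_image)
  have B: "f -` box l u \<in> sets borel"
    using measurable_sets_borel[OF \<open>f \<in> borel_measurable borel\<close>] by simp
  have "box l u \<in> lmeasurable" by simp
  then have 1: "inv f ` box l u \<in> lmeasurable" "measure lebesgue (inv f ` box l u) = measure lebesgue (box l u)"
    using measurable_orthogonal_image[OF g] measure_orthogonal_image[OF g] by auto
  have "emeasure (distr lborel borel f) (box l u) = emeasure lborel (f -` box l u)"
    by (simp add: emeasure_distr)
  also have "\<dots> = emeasure lebesgue (inv f ` box l u)"
    using B eq by simp
  also have "\<dots> = ennreal (measure lebesgue (box l u))"
    using 1 by (simp add: emeasure_eq_measure2 fmeasurableD2)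
  also have "\<dots> = (\<Prod>b\<in>Basis. (u - l) \<bullet> b)"
    using lu by (simp add: measure_lborel_box_eq)
  finally show "emeasure (distr lborel borel f) (box l u) = ennreal (\<Prod>b\<in>Basis. (u - l) \<bullet> b)" .
qed simp

definition emb :: "real ^ 2 \<Rightarrow> real \<Rightarrow> real ^ 3" where
  "emb y t = vector [y $ 1, y $ 2, t]"

lemma emb_nth [simp]: "emb y t $ 1 = y $ 1" "emb y t $ 2 = y $ 2" "emb y t $ 3 = t"
  by (simp_all add: emb_def)

lemma emb_continuous: "continuous_on UNIV (\<lambda>(y, t). emb y t)"
proof -
  have "(\<lambda>(y, t). emb y t) = (\<lambda>p. \<chi> i. if i = 1 then fst p $ 1 else if i = 2 then fst p $ 2 else snd p)"
    by (auto simp: fun_eq_iff vec_eq_iff forall_3)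
  moreover have "continuous_on UNIV (\<lambda>p :: (real ^ 2) \<times> real.
      if i = 1 then fst p $ 1 else if i = 2 then fst p $ 2 else snd p)" for i :: 3
    by (cases "i = 1"; cases "i = 2") (auto intro!: continuous_intros)
  ultimately show ?thesis
    by (auto intro!: continuous_on_vec_lambda)
qed

lemma emb_measurable [measurable (raw)]:
  assumes [measurable]: "f \<in> borel_measurable M" "g \<in> borel_measurable M"
  shows "(\<lambda>x. emb (f x) (g x)) \<in> borel_measurable M"
  using measurable_compose[OF borel_measurable_Pair[OF assms]
      borel_measurable_continuous_onI[OF emb_continuous]] by simp

lemma Basis_vec_real: "(Basis :: (real ^ 'n) set) = range (\<lambda>i. axis i 1)"
  by (auto simp: Basis_vec_def)

lemma prod_Basis_vec: "(\<Prod>b\<in>(Basis :: (real ^ 'n::finite) set). F b) = (\<Prod>i\<in>UNIV. F (axis i 1))"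
  unfolding Basis_vec_real by (subst prod.reindex) (auto simp: inj_on_def axis_eq_axis)

lemma mem_box_vec: "(x :: real ^ 'n) \<in> box l u \<longleftrightarrow> (\<forall>i. l $ i < x $ i \<and> x $ i < u $ i)"
  by (simp add: mem_box Basis_vec_real inner_axis)

lemma lborel_distr_emb: "distr lborel borel (\<lambda>(y, t). emb y t) = lborel"
proof (rule sym, rule lborel_eqI)
  fix l u :: "real ^ 3" assume lu: "\<And>b. b \<in> Basis \<Longrightarrow> l \<bullet> b \<le> u \<bullet> b"
  have le: "l $ i \<le> u $ i" for i
    using lu[of "axis i 1"] by (simp add: Basis_vec_real inner_axis)
  define l2 u2 :: "real ^ 2" where "l2 = vector [l $ 1, l $ 2]" and "u2 = vector [u $ 1, u $ 2]"
  have [measurable]: "(\<lambda>(y, t). emb y t) \<in> borel_measurable borel"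
    by (rule borel_measurable_continuous_onI[OF emb_continuous])
  have pre: "(\<lambda>(y, t). emb y t) -` box l u = box l2 u2 \<times> box (l $ 3) (u $ 3)"
    by (auto simp: mem_box_vec forall_2 forall_3 l2_def u2_def)
  have "emeasure (distr lborel borel (\<lambda>(y, t). emb y t)) (box l u)
      = emeasure (lborel \<Otimes>\<^sub>M lborel) (box l2 u2 \<times> box (l $ 3) (u $ 3))"
    by (simp add: emeasure_distr pre lborel_prod)
  also have "\<dots> = emeasure lborel (box l2 u2) * emeasure lborel (box (l $ 3) (u $ 3))"
    by (rule lborel.emeasure_pair_measure_Times) auto
  also have "\<dots> = (\<Prod>b\<in>Basis. (u - l) \<bullet> b)"
  proof -
    have "l2 \<bullet> b \<le> u2 \<bullet> b" if "b \<in> Basis" for b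
    proof -
      from that obtain i where "b = axis i 1" by (auto simp: Basis_vec_real)
      moreover have "i = 1 \<or> i = 2" by (rule exhaust_2)
      ultimately show ?thesis
        using le[of 1] le[of 2] by (auto simp: inner_axis l2_def u2_def)
    qed
    then have "emeasure lborel (box l2 u2) = (\<Prod>b\<in>Basis. (u2 - l2) \<bullet> b)"
      by (rule emeasure_lborel_box)
    also have "\<dots> = ennreal ((u $ 1 - l $ 1) * (u $ 2 - l $ 2))"
      unfolding prod_Basis_vec UNIV_2 by (simp add: inner_axis l2_def u2_def)
    finally show ?thesis
      unfolding prod_Basis_vec UNIV_3 using le[of 1] le[of 2] le[of 3]
      by (simp add: inner_axis mult.assoc flip: ennreal_mult)
  qed
  finally show "emeasure (distr lborel borel (\<lambda>(y, t). emb y t)) (box l u) = ennreal (\<Prod>b\<in>Basis. (u - l) \<bullet> b)" .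
qed simp

section \<open>Surface measure from a global chart\<close>

text \<open>Expanding both arguments in the basis, bilinearity and antisymmetry of the cross product
  leave only the 2 by 2 minor of the coefficients.\<close>

lemma linear_cross3_plane:
  fixes L :: "real ^ 2 \<Rightarrow> real ^ 3" and G :: "real ^ 2 \<Rightarrow> real ^ 2"
  assumes L: "linear L"
  shows "cross3 (L (G (axis 1 1))) (L (G (axis 2 1))) =
    det (matrix G) *\<^sub>R cross3 (L (axis 1 1)) (L (axis 2 1))"
proof -
  have e: "v = v $ 1 *\<^sub>R axis 1 1 + v $ 2 *\<^sub>R axis 2 1" for v :: "real ^ 2"
    by (simp add: vec_eq_iff forall_2 axis_def)
  have Lv: "L v = v $ 1 *\<^sub>R L (axis 1 1) + v $ 2 *\<^sub>R L (axis 2 1)" for v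
    by (subst e[of v]) (simp add: linear_add[OF L] linear_cmul[OF L])
  have m: "matrix G $ i $ j = G (axis j 1) $ i" for i j
    by (simp add: matrix_def)
  show ?thesis
    unfolding Lv[of "G _"] det_2 m
    by (simp add: cross_add_left cross_add_right cross_mult_left cross_mult_right algebra_simps
        cross_skew[of "L (axis 2 1)" "L (axis 1 1)"])
qed

text \<open>
  Uniqueness comes from applying the defining property to the chart itself. For existence, any
  other patch factors through the global chart, and the two area elements differ by the Jacobian
  determinant of the transition map.
\<close>

theorem surface_measure_global_chart:
  fixes \<phi> :: "real ^ 2 \<Rightarrow> real ^ 3" and \<pi> :: "real ^ 3 \<Rightarrow> real ^ 2"
  assumes patch: "regular_patch UNIV \<phi> \<phi>'" and range: "range \<phi> = S"
    and S: "S \<in> sets borel"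
    and pi: "bounded_linear \<pi>" "\<And>y. \<pi> (\<phi> y) = y"
  shows "surface_measure S =
    distr (density lborel (\<lambda>y. ennreal (norm (cross3 (\<phi>' y (axis 1 1)) (\<phi>' y (axis 2 1)))))) borel \<phi>"
    (is "_ = ?\<mu>")
proof -
  let ?J = "\<lambda>y. norm (cross3 (\<phi>' y (axis 1 1)) (\<phi>' y (axis 2 1)))"
  have der: "(\<phi> has_derivative \<phi>' y) (at y)"
    and cont: "continuous_on UNIV (\<lambda>y. \<phi>' y (axis i 1))" for y i
    using patch by (auto simp: regular_patch_def)
  have "continuous_on UNIV \<phi>"
    by (rule has_derivative_continuous_on) (rule has_derivative_at_withinI[OF der])
  then have [measurable]: "\<phi> \<in> borel_measurable borel"
    by (rule borel_measurable_continuous_onI)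
  have "continuous_on UNIV ?J"
    by (intro continuous_on_norm continuous_on_cross cont)
  then have J [measurable]: "?J \<in> borel_measurable borel"
    by (rule borel_measurable_continuous_onI)
  have em: "emeasure ?\<mu> A = (\<integral>\<^sup>+y. ennreal (?J y) * indicator {y. \<phi> y \<in> A} y \<partial>lborel)"
    if A: "A \<in> sets borel" for A
  proof -
    have "{y. \<phi> y \<in> A} \<in> sets borel"
      using measurable_sets_borel[OF \<open>\<phi> \<in> borel_measurable borel\<close> A] by (simp add: vimage_def)
    moreover have "\<phi> -` A = {y. \<phi> y \<in> A}" by auto
    ultimately show ?thesis
      using A by (simp add: emeasure_distr emeasure_density)
  qed
  have unique: "\<nu> = ?\<mu>" if nu: "is_surface_measure S \<nu>" for \<nu>
  proof (rule measure_eqI)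
    show "sets \<nu> = sets ?\<mu>" using nu by (simp add: is_surface_measure_def)
    fix A assume "A \<in> sets \<nu>"
    then have A: "A \<in> sets borel" using nu by (simp add: is_surface_measure_def)
    have sets [simp]: "sets \<nu> = sets borel" and null: "emeasure \<nu> (- S) = 0"
      using nu by (auto simp: is_surface_measure_def)
    have "A - S \<subseteq> - S" by auto
    then have "emeasure \<nu> (A - S) = 0"
      using null S by (metis emeasure_mono sets borel_comp le_zero_eq)
    moreover have "emeasure \<nu> A = emeasure \<nu> (A \<inter> S) + emeasure \<nu> (A - S)"
      using A S by (subst plus_emeasure) (auto intro!: arg_cong[where f = "emeasure \<nu>"])
    ultimately have "emeasure \<nu> A = emeasure \<nu> (A \<inter> S)" by simp
    also have "\<dots> = (\<integral>\<^sup>+y. ennreal (?J y) * indicator {y \<in> UNIV. \<phi> y \<in> A \<inter> S} y \<partial>lborel)"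
    proof -
      have "\<phi> ` UNIV \<subseteq> S" "A \<inter> S \<in> sets borel" "A \<inter> S \<subseteq> \<phi> ` UNIV" using range A S by auto
      then show ?thesis using nu patch unfolding is_surface_measure_def by blast
    qed
    also have "{y \<in> UNIV. \<phi> y \<in> A \<inter> S} = {y. \<phi> y \<in> A}" using range by auto
    finally show "emeasure \<nu> A = emeasure ?\<mu> A" using em[OF A] by simp
  qed
  have "is_surface_measure S ?\<mu>"
    unfolding is_surface_measure_def
  proof (intro conjI allI impI)
    show "sets ?\<mu> = sets borel" by simp
    show "emeasure ?\<mu> (- S) = 0"
    proof -
      have e: "{y. \<phi> y \<in> - S} = {}" using range by auto
      show ?thesis using em[of "- S"] S unfolding e by simp
    qed
    fix U \<psi> \<psi>' A
    assume psi: "regular_patch U \<psi> \<psi>'" and US: "\<psi> ` U \<subseteq> S" and A: "A \<in> sets borel" "A \<subseteq> \<psi> ` U"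
    have U: "open U" and inj: "inj_on \<psi> U"
      and der_psi: "y \<in> U \<Longrightarrow> (\<psi> has_derivative \<psi>' y) (at y)"
      and cont_psi: "continuous_on U (\<lambda>y. \<psi>' y (axis i 1))" for y i
      using psi by (auto simp: regular_patch_def)
    \<comment> \<open>The image of \<psi> lies in the range of \<phi>, where \<pi> inverts \<phi>,
      so \<open>g\<close> is the transition map. Since \<pi> is linear on the whole space,
      \<open>g\<close> is differentiable without an inverse function theorem.\<close>
    define g where "g = \<pi> \<circ> \<psi>"
    define g' where "g' y = \<pi> \<circ> \<psi>' y" for y
    have phi_g: "\<phi> (g y) = \<psi> y" if "y \<in> U" for y
    proof -
      have "\<psi> y \<in> range \<phi>" using that US range by auto
      then show ?thesis using pi(2) by (auto simp: g_def)
    qed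
    have derg: "(g has_derivative g' y) (at y)" if "y \<in> U" for y
      using bounded_linear.has_derivative[OF pi(1) der_psi[OF that]] by (simp add: g_def g'_def o_def)
    have "inj_on g U" using inj phi_g by (metis inj_on_def)
    have chain: "\<psi>' y = \<phi>' (g y) \<circ> g' y" if y: "y \<in> U" for y
    proof -
      have "(\<phi> \<circ> g has_derivative \<phi>' (g y) \<circ> g' y) (at y)"
        using derg[OF y] der by (rule diff_chain_at)
      then have "(\<psi> has_derivative \<phi>' (g y) \<circ> g' y) (at y)"
        by (rule has_derivative_transform_within_open[OF _ U y]) (simp add: phi_g)
      then show ?thesis using has_derivative_unique[OF der_psi[OF y]] by simp
    qed
    have J_psi: "\<bar>det (matrix (g' y))\<bar> * ?J (g y) = norm (cross3 (\<psi>' y (axis 1 1)) (\<psi>' y (axis 2 1)))"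
      if "y \<in> U" for y
      using linear_cross3_plane[of "\<phi>' (g y)" "g' y"] has_derivative_linear[OF der] chain[OF that]
      by simp
    let ?f = "\<lambda>z. ?J z * indicator A (\<phi> z)"
    have Uset: "U \<in> sets borel" using U by simp
    \<comment> \<open>\<open>A\<close> lies in the image of the patch, so the indicator of the image
      of \<open>U\<close> under \<open>g\<close> can be inserted or removed freely.\<close>
    have f_img: "?f z * indicator (g ` U) z = ?f z" for z
    proof (cases "\<phi> z \<in> A")
      case True
      then obtain y where "y \<in> U" "\<phi> z = \<psi> y" using A by auto
      then have "z = g y" using pi(2) by (metis comp_apply g_def)
      then show ?thesis using \<open>y \<in> U\<close> by simp
    qed simp
    have D: "\<bar>det (matrix (g' y))\<bar> * ?f (g y) * indicator U y =
        norm (cross3 (\<psi>' y (axis 1 1)) (\<psi>' y (axis 2 1))) * indicator U y * indicator {y \<in> U. \<psi> y \<in> A} y" for y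
    proof (cases "y \<in> U")
      case True
      then show ?thesis using J_psi[OF True] phi_g[OF True] by (simp add: indicator_def)
    qed simp
    have contc: "continuous_on U (\<lambda>y. norm (cross3 (\<psi>' y (axis 1 1)) (\<psi>' y (axis 2 1))))"
      by (intro continuous_on_norm continuous_on_cross cont_psi)
    have "continuous_on U \<psi>"
      by (rule has_derivative_continuous_on) (rule has_derivative_at_withinI[OF der_psi])
    \<comment> \<open>Extending \<psi> by 0 gives a Borel map on the whole plane; intersecting with
      \<open>U\<close> afterwards discards the points where only the default value was used.\<close>
    then have "(\<lambda>y. if y \<in> U then \<psi> y else 0) \<in> borel_measurable borel"
      by (rule borel_measurable_continuous_on_if[OF Uset]) simp
    from measurable_sets_borel[OF this A(1)] have "U \<inter> (\<lambda>y. if y \<in> U then \<psi> y else 0) -` A \<in> sets borel"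
      using Uset by blast
    also have "U \<inter> (\<lambda>y. if y \<in> U then \<psi> y else 0) -` A = {y \<in> U. \<psi> y \<in> A}" by auto
    finally have B: "{y \<in> U. \<psi> y \<in> A} \<in> sets borel" .
    have M2: "(\<lambda>y. \<bar>det (matrix (g' y))\<bar> * ?f (g y) * indicator U y) \<in> borel_measurable borel"
    proof -
      have "(\<lambda>y. indicator U y *\<^sub>R norm (cross3 (\<psi>' y (axis 1 1)) (\<psi>' y (axis 2 1)))) \<in> borel_measurable borel"
        using contc Uset by (rule borel_measurable_continuous_on_indicator[rotated])
      then show ?thesis unfolding D using B by (simp add: mult.commute)
    qed
    have "emeasure ?\<mu> A = (\<integral>\<^sup>+z. ennreal (?f z) * indicator (g ` U) z \<partial>lborel)"
      unfolding em[OF A(1)]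
    proof (rule nn_integral_cong)
      fix z
      have "ennreal (?f z) * indicator (g ` U) z = ennreal (?f z)"
        using f_img[of z] by (metis ennreal_indicator ennreal_mult'' indicator_pos_le)
      then show "ennreal (?J z) * indicator {y. \<phi> y \<in> A} z = ennreal (?f z) * indicator (g ` U) z"
        by (simp add: indicator_def)
    qed
    also have "\<dots> = (\<integral>\<^sup>+y. ennreal (\<bar>det (matrix (g' y))\<bar> * ?f (g y)) * indicator U y \<partial>lborel)"
      by (rule nn_integral_change_of_variables[OF Uset has_derivative_at_withinI[OF derg] \<open>inj_on g U\<close> _ _ M2])
        (use f_img A in \<open>auto simp: f_img\<close>)
    also have "\<dots> = (\<integral>\<^sup>+y. ennreal (norm (cross3 (\<psi>' y (axis 1 1)) (\<psi>' y (axis 2 1)))) *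
        indicator {y \<in> U. \<psi> y \<in> A} y \<partial>lborel)"
    proof (rule nn_integral_cong)
      fix y
      show "ennreal (\<bar>det (matrix (g' y))\<bar> * ?f (g y)) * indicator U y =
        ennreal (norm (cross3 (\<psi>' y (axis 1 1)) (\<psi>' y (axis 2 1)))) * indicator {y \<in> U. \<psi> y \<in> A} y"
        using J_psi[of y] phi_g[of y] by (cases "y \<in> U"; cases "\<psi> y \<in> A") auto
    qed
    finally show "emeasure ?\<mu> A = (\<integral>\<^sup>+y. ennreal (norm (cross3 (\<psi>' y (axis 1 1)) (\<psi>' y (axis 2 1)))) *
        indicator {y \<in> U. \<psi> y \<in> A} y \<partial>lborel)" .
  qed
  then show ?thesis
    unfolding surface_measure_def using unique by (rule the_equality)
qed

section \<open>Cylindrical coordinates with a prescribed axis\<close>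

text \<open>
  The Householder reflection exchanging \<open>e\<^sub>3\<close> and \<open>x / |x|\<close>. If the two coincide, then \<open>d = 0\<close>
  and the convention \<open>0 / 0 = 0\<close> makes this the identity.
\<close>

definition frame :: "real ^ 3 \<Rightarrow> real ^ 3 \<Rightarrow> real ^ 3" where
  "frame x v = (let d = axis 3 1 - x /\<^sub>R norm x in v - (2 * (d \<bullet> v) / (d \<bullet> d)) *\<^sub>R d)"

lemma linear_frame: "linear (frame x)"
  by (rule linearI) (simp_all add: frame_def Let_def inner_add_right algebra_simps add_divide_distrib)

lemma norm_frame [simp]: "norm (frame x v) = norm v"
proof -
  define d where "d = axis 3 1 - x /\<^sub>R norm x"
  have "(frame x v) \<bullet> (frame x v) = v \<bullet> v"
  proof (cases "d = 0")
    case False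
    then have "d \<bullet> d \<noteq> 0" by simp
    then show ?thesis
      by (simp add: frame_def Let_def flip: d_def)
        (simp add: inner_diff_left inner_diff_right inner_commute field_simps)
  qed (simp add: frame_def Let_def flip: d_def)
  then show ?thesis by (simp add: norm_eq_sqrt_inner)
qed

lemma orthogonal_frame: "orthogonal_transformation (frame x)"
  by (simp add: orthogonal_transformation linear_frame)

lemma inner_frame [simp]: "frame x v \<bullet> frame x w = v \<bullet> w"
  using orthogonal_frame by (simp add: orthogonal_transformation_def)

lemma frame_frame [simp]: "frame x (frame x v) = v"
proof -
  define d where "d = axis 3 1 - x /\<^sub>R norm x"
  have f: "frame x w = w - (2 * (d \<bullet> w) / (d \<bullet> d)) *\<^sub>R d" for w
    by (simp add: frame_def d_def Let_def)
  show ?thesis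
  proof (cases "d = 0")
    case False
    then have "d \<bullet> frame x v = - (d \<bullet> v)"
      by (simp add: f inner_diff_right)
    then show ?thesis by (subst f) (simp add: f)
  qed (simp add: f)
qed

text \<open>For the difference \<open>d\<close> of two unit vectors, the first being
  \<open>axis 3 1\<close>, one has \<open>d \<bullet> d = 2 * (d \<bullet> axis 3 1)\<close>, so the
  reflection subtracts exactly \<open>d\<close> from \<open>axis 3 1\<close>.\<close>

lemma frame_axis: "x \<noteq> 0 \<Longrightarrow> norm x *\<^sub>R frame x (axis 3 1) = x"
proof -
  assume x: "x \<noteq> 0"
  define u d :: "real ^ 3" where "u = x /\<^sub>R norm x" and "d = axis 3 1 - u"
  have uu: "u \<bullet> u = 1" using x by (simp add: u_def flip: power2_norm_eq_inner)
  have ee: "axis 3 1 \<bullet> (axis 3 1 :: real ^ 3) = 1" by (simp add: inner_axis)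
  have dd: "d \<bullet> d = 2 * (d \<bullet> axis 3 1)"
    by (simp add: d_def inner_diff_left inner_diff_right uu ee inner_commute)
  have f: "frame x (axis 3 1) = axis 3 1 - (2 * (d \<bullet> axis 3 1) / (d \<bullet> d)) *\<^sub>R d"
    by (simp add: frame_def d_def u_def Let_def)
  have "frame x (axis 3 1) = u"
  proof (cases "d = 0")
    case False
    then have "d \<bullet> d \<noteq> 0" by (simp only: inner_eq_zero_iff not_False_eq_True)
    then have "2 * (d \<bullet> axis 3 1) / (d \<bullet> d) = 1" by (simp only: dd[symmetric]) simp
    then have "frame x (axis 3 1) = axis 3 1 - 1 *\<^sub>R d" using f by (simp only:)
    then show ?thesis by (simp add: d_def)
  qed (use f d_def in simp)
  then show ?thesis using x by (simp add: u_def)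
qed

lemma inner_frame_right: "x \<bullet> frame x v = norm x * v $ 3"
proof (cases "x = 0")
  case False
  have "x \<bullet> frame x v = (norm x *\<^sub>R frame x (axis 3 1)) \<bullet> frame x v"
    using frame_axis[OF False] by simp
  then show ?thesis by (simp add: inner_axis')
qed simp

text \<open>A frame cannot depend continuously on the direction of its axis over the whole sphere
  (hairy ball theorem). Borel dependence suffices for integrating over \<open>x\<close>.\<close>

lemma borel_measurable_frame [measurable (raw)]:
  assumes [measurable]: "f \<in> borel_measurable M" "g \<in> borel_measurable M"
  shows "(\<lambda>z. frame (f z) (g z)) \<in> borel_measurable M"
  unfolding frame_def Let_def by measurable

definition coord :: "real ^ 3 \<Rightarrow> real ^ 2 \<Rightarrow> real \<Rightarrow> real ^ 3" where
  "coord x y t = frame x (emb y t)"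

lemma borel_measurable_coord [measurable (raw)]:
  assumes [measurable]: "f \<in> borel_measurable M" "g \<in> borel_measurable M" "h \<in> borel_measurable M"
  shows "(\<lambda>z. coord (f z) (g z) (h z)) \<in> borel_measurable M"
  unfolding coord_def by measurable

lemma norm_vec2: "(norm (y :: real ^ 2))\<^sup>2 = (y $ 1)\<^sup>2 + (y $ 2)\<^sup>2"
  by (simp only: power2_norm_eq_inner) (simp add: inner_vec_def sum_2 power2_eq_square)

lemma norm_vec3: "(norm (y :: real ^ 3))\<^sup>2 = (y $ 1)\<^sup>2 + (y $ 2)\<^sup>2 + (y $ 3)\<^sup>2"
  by (simp only: power2_norm_eq_inner) (simp add: inner_vec_def sum_3 power2_eq_square)

lemma norm_coord: "(norm (coord x y t))\<^sup>2 = (norm y)\<^sup>2 + t\<^sup>2"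
  by (simp add: coord_def norm_vec3 norm_vec2)

text \<open>Since \<open>x\<close> points along the axis, adding it moves only the axial coordinate.
  This reduces the gap between the energies of \<open>q'\<close> and \<open>q' + x\<close> to a
  function of \<open>t\<close> alone once \<open>x\<close> and \<open>y\<close> are fixed.\<close>

lemma norm_coord_shift: "(norm (coord x y t + x))\<^sup>2 = (norm y)\<^sup>2 + (t + norm x)\<^sup>2"
proof -
  have "(norm (coord x y t + x))\<^sup>2 = (norm (coord x y t))\<^sup>2 + 2 * (x \<bullet> coord x y t) + (norm x)\<^sup>2"
    by (simp add: power2_norm_eq_inner inner_add_left inner_add_right inner_commute)
  also have "x \<bullet> coord x y t = norm x * t"
    by (simp add: coord_def inner_frame_right)
  finally show ?thesis using norm_coord[of x y t] by (simp add: power2_sum)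
qed

lemma nn_integral_coord:
  assumes [measurable]: "F \<in> borel_measurable borel"
  shows "(\<integral>\<^sup>+q. F q \<partial>lborel) = (\<integral>\<^sup>+y. \<integral>\<^sup>+t. F (coord x y t) \<partial>lborel \<partial>lborel)"
proof -
  have [measurable]: "(\<lambda>(y, t). emb y t) \<in> borel_measurable borel"
    by (rule borel_measurable_continuous_onI[OF emb_continuous])
  have [measurable]: "frame x \<in> borel_measurable borel"
    using linear_frame[of x]
    by (intro borel_measurable_continuous_onI linear_continuous_on)
      (simp add: linear_conv_bounded_linear)
  have "(\<integral>\<^sup>+q. F q \<partial>lborel) = (\<integral>\<^sup>+q. F q \<partial>distr lborel borel (frame x))"
    by (simp only: lborel_distr_orthogonal_transformation[OF orthogonal_frame])
  also have "\<dots> = (\<integral>\<^sup>+v. F (frame x v) \<partial>lborel)"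
    by (simp add: nn_integral_distr)
  also have "\<dots> = (\<integral>\<^sup>+v. F (frame x v) \<partial>distr lborel borel (\<lambda>(y, t). emb y t))"
    by (simp only: lborel_distr_emb)
  also have "\<dots> = (\<integral>\<^sup>+(y, t). F (coord x y t) \<partial>(lborel \<Otimes>\<^sub>M lborel))"
    by (subst nn_integral_distr, (measurable)[2], simp add: lborel_prod coord_def case_prod_unfold)
  also have "\<dots> = (\<integral>\<^sup>+y. \<integral>\<^sup>+t. F (coord x y t) \<partial>lborel \<partial>lborel)"
    by (subst lborel.nn_integral_fst[symmetric]) (auto simp: case_prod_unfold)
  finally show ?thesis .
qed

text \<open>Integrability of \<open>1 / |x|\<close> follows by Fubini from \<open>1 / |x| \<le> |x\<^sub>1|\<^sup>-\<^sup>1\<^sup>/\<^sup>2 |x\<^sub>2|\<^sup>-\<^sup>1\<^sup>/\<^sup>2\<close>.\<close>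

lemma nn_integral_inverse_norm_finite:
  "(\<integral>\<^sup>+(x :: real ^ 3). ennreal (1 / norm x) * indicator (cball 0 r) x \<partial>lborel) < \<infinity>"
proof -
  define I where "I t = ennreal (\<bar>t\<bar> powr (- 1 / 2)) * indicator {- r..r} t" for t
  have [measurable]: "I \<in> borel_measurable borel" unfolding I_def by measurable
  have half: "(\<integral>\<^sup>+t. ennreal (t powr (- 1 / 2)) * indicator {0..R} t \<partial>lborel) < \<infinity>" for R :: real
  proof (cases "0 \<le> R")
    case True
    have "((\<lambda>t. t powr (- 1 / 2)) has_integral (R powr (- 1 / 2 + 1) / (- 1 / 2 + 1))) {0..R}"
      using True by (intro has_integral_powr_from_0) auto
    from nn_integral_has_integral_lebesgue'[OF _ this] show ?thesis by auto
  qed simp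
  have I: "(\<integral>\<^sup>+t. I t \<partial>lborel) < \<infinity>"
  proof -
    have "(\<integral>\<^sup>+t. I t \<partial>lborel) \<le> (\<integral>\<^sup>+t. ennreal (t powr (- 1 / 2)) * indicator {0..r} t +
        ennreal ((- t) powr (- 1 / 2)) * indicator {0..r} (- t) \<partial>lborel)"
      by (intro nn_integral_mono) (auto simp: I_def indicator_def abs_if)
    also have "\<dots> = (\<integral>\<^sup>+t. ennreal (t powr (- 1 / 2)) * indicator {0..r} t \<partial>lborel) +
        (\<integral>\<^sup>+t. ennreal ((- t) powr (- 1 / 2)) * indicator {0..r} (- t) \<partial>lborel)"
      by (rule nn_integral_add) auto
    also have "(\<integral>\<^sup>+t. ennreal ((- t) powr (- 1 / 2)) * indicator {0..r} (- t) \<partial>lborel)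
        = (\<integral>\<^sup>+t. ennreal (t powr (- 1 / 2)) * indicator {0..r} t \<partial>lborel)"
      by (subst (2) nn_integral_real_affine[where c = "-1" and t = 0]) auto
    finally show ?thesis using half[of r] by (simp add: le_less_trans)
  qed
  define f :: "real ^ 3 \<Rightarrow> real \<Rightarrow> ennreal"
    where "f b = (if b = axis 3 1 then indicator {- r..r} else I)" for b
  define K where "K v = I (v $ 1) * (I (v $ 2) * indicator {- r..r} (v $ 3))" for v :: "real ^ 3"
  have K: "K v = (\<Prod>b\<in>Basis. f b (v \<bullet> b))" for v
    unfolding prod_Basis_vec UNIV_3 by (simp add: K_def f_def inner_axis axis_eq_axis)
  \<comment> \<open>The coordinate planes must be excluded: \<open>0 powr (- 1 / 2)\<close> is 0, so
    \<open>K\<close> vanishes there while \<open>1 / norm x\<close> does not. They form a null set,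
    treated in \<open>AE0\<close>.\<close>
  have bound: "ennreal (1 / norm x) * indicator (cball 0 r) x \<le> K x" if x: "x $ 1 \<noteq> 0" "x $ 2 \<noteq> 0" for x :: "real ^ 3"
  proof (cases "norm x \<le> r")
    case True
    have c: "\<bar>x $ i\<bar> \<le> r" for i using component_le_norm_cart[of x i] True by linarith
    have pos: "0 < \<bar>x $ 1\<bar> * \<bar>x $ 2\<bar>" using x by simp
    have "\<bar>x $ 1\<bar> * \<bar>x $ 2\<bar> \<le> norm x * norm x"
      by (intro mult_mono component_le_norm_cart) auto
    then have "sqrt (\<bar>x $ 1\<bar> * \<bar>x $ 2\<bar>) \<le> norm x"
      by (intro real_le_lsqrt) (auto simp: power2_eq_square)
    then have "1 / norm x \<le> 1 / sqrt (\<bar>x $ 1\<bar> * \<bar>x $ 2\<bar>)"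
      using pos by (intro divide_left_mono) (auto intro!: mult_pos_pos)
    also have "\<dots> = \<bar>x $ 1\<bar> powr (- 1 / 2) * \<bar>x $ 2\<bar> powr (- 1 / 2)"
      using x by (simp add: powr_minus_divide powr_half_sqrt real_sqrt_mult)
    finally have le: "1 / norm x \<le> \<bar>x $ 1\<bar> powr (- 1 / 2) * \<bar>x $ 2\<bar> powr (- 1 / 2)" .
    have mem: "x $ i \<in> {- r..r}" for i using c[of i] by (simp add: abs_le_iff)
    have "K x = ennreal (\<bar>x $ 1\<bar> powr (- 1 / 2) * \<bar>x $ 2\<bar> powr (- 1 / 2))"
      unfolding K_def I_def indicator_simps(1)[OF mem] by (simp add: ennreal_mult)
    moreover have "x \<in> cball 0 r" using True by simp
    ultimately show ?thesis using ennreal_leI[OF le] by simp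
  qed (simp add: indicator_def)
  have AE0: "AE x :: real ^ 3 in lborel. x $ i \<noteq> 0" for i
  proof (rule AE_I')
    have "{x :: real ^ 3. axis i 1 \<bullet> x = 0} \<in> null_sets lebesgue"
      using negligible_hyperplane[of "axis i 1 :: real ^ 3" 0] by (simp add: negligible_iff_null_sets)
    moreover have "closed {x :: real ^ 3. axis i 1 \<bullet> x = 0}" by (rule closed_hyperplane)
    ultimately show "{x :: real ^ 3. axis i 1 \<bullet> x = 0} \<in> null_sets lborel"
      by (auto simp: null_sets_def)
  qed (auto simp: inner_axis')
  have "(\<integral>\<^sup>+(x :: real ^ 3). ennreal (1 / norm x) * indicator (cball 0 r) x \<partial>lborel) \<le> (\<integral>\<^sup>+x. K x \<partial>lborel)"
    using AE0[of 1] AE0[of 2] by (intro nn_integral_mono_AE) (auto elim!: eventually_elim2 intro: bound)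
  also have "(\<integral>\<^sup>+x. K x \<partial>lborel) = (\<Prod>b\<in>Basis. \<integral>\<^sup>+t. f b t \<partial>lborel)"
    unfolding K by (rule nn_integral_lborel_prod) (auto simp: f_def)
  also have "\<dots> = (\<integral>\<^sup>+t. I t \<partial>lborel) * ((\<integral>\<^sup>+t. I t \<partial>lborel) * emeasure lborel {- r..r})"
    unfolding prod_Basis_vec UNIV_3 by (simp add: f_def axis_eq_axis)
  also have "\<dots> < \<infinity>"
    using I by (auto simp: ennreal_mult_less_top emeasure_lborel_Icc_eq)
  finally show ?thesis .
qed

section \<open>The energy gap along the axis\<close>

text \<open>
  Here \<open>m = 1 + |y|\<^sup>2\<close>, \<open>a = |x|\<close> and \<open>t\<close> is the axial coordinate of \<open>q'\<close>. On the level set where the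
  gap equals \<open>h\<close>, the energies of \<open>q'\<close> and \<open>q' + x\<close> are \<open>R - h / 2\<close> and \<open>R + h / 2\<close> with \<open>R\<close> the
  value of \<open>mid_energy\<close>.
\<close>

definition slice_energy :: "real \<Rightarrow> real \<Rightarrow> real" where
  "slice_energy m t = sqrt (m + t\<^sup>2)"

definition energy_gap :: "real \<Rightarrow> real \<Rightarrow> real \<Rightarrow> real" where
  "energy_gap m a t = slice_energy m (t + a) - slice_energy m t"

definition mid_energy :: "real \<Rightarrow> real \<Rightarrow> real \<Rightarrow> real" where
  "mid_energy m a h = sqrt (m / (1 - (h / a)\<^sup>2) + a\<^sup>2 / 4)"

text \<open>Gap times sum of the energies is the difference of their squares:
  \<open>h * (2 * R) = a * (2 * t + a)\<close>, which gives \<open>t\<close>. Inserting this into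
  \<open>(R - h / 2)^2 = m + t^2\<close> determines \<open>R\<close>, with the value of
  \<open>mid_energy\<close>.\<close>

definition gap_inv :: "real \<Rightarrow> real \<Rightarrow> real \<Rightarrow> real" where
  "gap_inv m a h = h / a * mid_energy m a h - a / 2"

text \<open>The reciprocal of the \<open>t\<close>-derivative of the gap: with energies e and e' at
  \<open>t\<close> and \<open>t + a\<close>, that derivative is \<open>(t + a) / e' - t / e\<close>,
  which equals \<open>(a * e - t * h) / (e * e')\<close> because \<open>e' = e + h\<close>.\<close>

definition gap_jac :: "real \<Rightarrow> real \<Rightarrow> real \<Rightarrow> real" where
  "gap_jac m a h = slice_energy m (gap_inv m a h) * slice_energy m (gap_inv m a h + a) /
     (a * slice_energy m (gap_inv m a h) - gap_inv m a h * h)"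

lemma borel_measurable_slice_energy [measurable (raw)]:
  assumes [measurable]: "f \<in> borel_measurable M" "g \<in> borel_measurable M"
  shows "(\<lambda>z. slice_energy (f z) (g z)) \<in> borel_measurable M"
  unfolding slice_energy_def by measurable

lemma borel_measurable_energy_gap [measurable (raw)]:
  assumes [measurable]: "f \<in> borel_measurable M" "g \<in> borel_measurable M" "h \<in> borel_measurable M"
  shows "(\<lambda>z. energy_gap (f z) (g z) (h z)) \<in> borel_measurable M"
  unfolding energy_gap_def by measurable

lemma borel_measurable_gap_inv [measurable (raw)]:
  assumes [measurable]: "f \<in> borel_measurable M" "g \<in> borel_measurable M" "h \<in> borel_measurable M"
  shows "(\<lambda>z. gap_inv (f z) (g z) (h z)) \<in> borel_measurable M"
  unfolding gap_inv_def mid_energy_def by measurable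

lemma borel_measurable_gap_jac [measurable (raw)]:
  assumes [measurable]: "f \<in> borel_measurable M" "g \<in> borel_measurable M" "h \<in> borel_measurable M"
  shows "(\<lambda>z. gap_jac (f z) (g z) (h z)) \<in> borel_measurable M"
  unfolding gap_jac_def by measurable

context
  fixes m :: real
  assumes m: "0 < m"
begin

lemma slice_energy_sq: "(slice_energy m t)\<^sup>2 = m + t\<^sup>2"
  using m by (simp add: slice_energy_def add_nonneg_nonneg)

lemma abs_less_slice_energy: "\<bar>t\<bar> < slice_energy m t"
  using m by (simp add: slice_energy_def real_less_rsqrt)

lemma slice_energy_pos: "0 < slice_energy m t"
  using abs_less_slice_energy[of t] by linarith

lemma slice_energy_eqI: "0 \<le> r \<Longrightarrow> r\<^sup>2 = m + t\<^sup>2 \<Longrightarrow> slice_energy m t = r"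
  by (simp add: slice_energy_def real_sqrt_unique)

lemma has_field_derivative_slice_energy:
  "(slice_energy m has_field_derivative t / slice_energy m t) (at t)"
proof -
  have "0 < m + t\<^sup>2" using m by (simp add: add_pos_nonneg)
  then show ?thesis unfolding slice_energy_def
    by (auto intro!: derivative_eq_intros simp: field_simps)
qed

context
  fixes a :: real
  assumes a: "0 < a"
begin

context
  fixes h :: real
  assumes h: "\<bar>h\<bar> < a"
begin

lemma one_minus_ratio_pos: "0 < 1 - (h / a)\<^sup>2"
proof -
  have "\<bar>h / a\<bar> < 1" using h a by simp
  then show ?thesis by (simp add: abs_square_less_1)
qed

lemma mid_energy_sq: "(mid_energy m a h)\<^sup>2 = m / (1 - (h / a)\<^sup>2) + a\<^sup>2 / 4"
  unfolding mid_energy_def using one_minus_ratio_pos m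
  by (intro real_sqrt_pow2 add_nonneg_nonneg divide_nonneg_pos) auto

lemma half_less_mid_energy: "a / 2 < mid_energy m a h"
  unfolding mid_energy_def using one_minus_ratio_pos m
  by (intro real_less_rsqrt) (simp add: power_divide)

lemma mid_energy_pos: "0 < mid_energy m a h"
  using half_less_mid_energy a by linarith

lemma mid_energy_eq: "(mid_energy m a h)\<^sup>2 * (1 - (h / a)\<^sup>2) = m + a\<^sup>2 / 4 * (1 - (h / a)\<^sup>2)"
  unfolding mid_energy_sq using one_minus_ratio_pos by (simp add: distrib_right)

lemma slice_energy_gap_inv: "slice_energy m (gap_inv m a h) = mid_energy m a h - h / 2"
proof (rule slice_energy_eqI)
  show "0 \<le> mid_energy m a h - h / 2" using half_less_mid_energy h by linarith
  define k where "k = h / a"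
  have hk: "h = k * a" using a by (simp add: k_def)
  have "(mid_energy m a h)\<^sup>2 * (1 - k\<^sup>2) = m + a\<^sup>2 / 4 * (1 - k\<^sup>2)"
    using mid_energy_eq by (simp add: k_def)
  then show "(mid_energy m a h - h / 2)\<^sup>2 = m + (gap_inv m a h)\<^sup>2"
    unfolding gap_inv_def k_def[symmetric]
    by (subst (2) hk) (simp add: power2_eq_square algebra_simps diff_divide_distrib)
qed

lemma slice_energy_gap_inv_shift: "slice_energy m (gap_inv m a h + a) = mid_energy m a h + h / 2"
proof (rule slice_energy_eqI)
  show "0 \<le> mid_energy m a h + h / 2" using half_less_mid_energy h by linarith
  define k where "k = h / a"
  have hk: "h = k * a" using a by (simp add: k_def)
  have "(mid_energy m a h)\<^sup>2 * (1 - k\<^sup>2) = m + a\<^sup>2 / 4 * (1 - k\<^sup>2)"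
    using mid_energy_eq by (simp add: k_def)
  then show "(mid_energy m a h + h / 2)\<^sup>2 = m + (gap_inv m a h + a)\<^sup>2"
    unfolding gap_inv_def k_def[symmetric]
    by (subst (2) hk) (simp add: power2_eq_square algebra_simps diff_divide_distrib)
qed

lemma energy_gap_gap_inv: "energy_gap m a (gap_inv m a h) = h"
  by (simp add: energy_gap_def slice_energy_gap_inv slice_energy_gap_inv_shift)

text \<open>As |h| < a, it is enough to bound e - |t| = m / (e + |t|) from below by m / (2 e), where
  e is the slice energy. The explicit bound, beyond mere positivity, is what yields the factor 1 / a
  in \<open>gap_jac_le\<close>.\<close>

lemma gap_denominator_bound: "a * m / (2 * slice_energy m t) \<le> a * slice_energy m t - t * h"
proof -
  let ?e = "slice_energy m t"
  have "m = (?e - \<bar>t\<bar>) * (?e + \<bar>t\<bar>)"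
    using slice_energy_sq[of t] by (simp add: power2_eq_square algebra_simps)
  also have "\<dots> \<le> (?e - \<bar>t\<bar>) * (2 * ?e)"
    using abs_less_slice_energy[of t] by (intro mult_left_mono) auto
  finally have "m / (2 * ?e) \<le> ?e - \<bar>t\<bar>"
    using slice_energy_pos[of t] by (simp add: pos_divide_le_eq)
  then have "a * (m / (2 * ?e)) \<le> a * (?e - \<bar>t\<bar>)"
    using a by (intro mult_left_mono) auto
  moreover have "t * h \<le> \<bar>t\<bar> * a"
    by (rule order_trans[OF abs_ge_self]) (use h in \<open>simp add: abs_mult mult_left_mono\<close>)
  ultimately show ?thesis by (simp add: algebra_simps)
qed

lemma gap_denominator_pos: "0 < a * slice_energy m t - t * h"
  using gap_denominator_bound[of t] m a slice_energy_pos[of t]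
  by (meson divide_pos_pos less_le_trans mult_pos_pos zero_less_numeral)

text \<open>Inserting \<open>R - h / 2\<close> for the energy makes the terms with
  \<open>a * h / 2\<close> cancel. The factored form is the denominator of
  \<open>chart_slope\<close> up to the factor \<open>a\<close>, which links the slope of the chart
  to the Jacobian.\<close>

lemma gap_denominator_eq:
  "a * slice_energy m (gap_inv m a h) - gap_inv m a h * h = a * (1 - (h / a)\<^sup>2) * mid_energy m a h"
  unfolding slice_energy_gap_inv using a by (simp add: gap_inv_def power2_eq_square field_simps)

lemma gap_jac_pos: "0 < gap_jac m a h"
  unfolding gap_jac_def using gap_denominator_pos slice_energy_pos by simp

text \<open>Source of the integrable dominating function: on bounded sets both energies are bounded,
  and \<open>m \<ge> 1\<close> in the application, which leaves a multiple of 1 / a.\<close>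

lemma gap_jac_le:
  "gap_jac m a h \<le> 2 * (slice_energy m (gap_inv m a h))\<^sup>2 * slice_energy m (gap_inv m a h + a) / (a * m)"
proof -
  define e e' where "e = slice_energy m (gap_inv m a h)" and "e' = slice_energy m (gap_inv m a h + a)"
  have pos: "0 < e" "0 < e'" using slice_energy_pos by (auto simp: e_def e'_def)
  have "gap_jac m a h = e * e' / (a * e - gap_inv m a h * h)"
    by (simp add: gap_jac_def e_def e'_def)
  also have "\<dots> \<le> e * e' / (a * m / (2 * e))"
    using gap_denominator_bound[of "gap_inv m a h"] pos a m gap_denominator_pos[of "gap_inv m a h"]
    by (intro divide_left_mono) (auto simp: e_def)
  also have "\<dots> = 2 * e\<^sup>2 * e' / (a * m)"
    using pos a m by (simp add: power2_eq_square field_simps)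
  finally show ?thesis by (simp add: e_def e'_def)
qed

end

text \<open>The gap times the sum of the energies is \<open>a * (2 * t + a)\<close>, and that sum
  strictly exceeds |t + a| + |t|, hence also |2 t + a|, because \<open>m\<close> is
  positive.\<close>

lemma abs_energy_gap_less: "\<bar>energy_gap m a t\<bar> < a"
proof -
  let ?s = "slice_energy m (t + a) + slice_energy m t"
  have s: "\<bar>t + a\<bar> + \<bar>t\<bar> < ?s"
    using abs_less_slice_energy[of t] abs_less_slice_energy[of "t + a"] by linarith
  have "energy_gap m a t * ?s = a * (2 * t + a)"
    using slice_energy_sq[of t] slice_energy_sq[of "t + a"]
    by (simp add: energy_gap_def algebra_simps power2_eq_square)
  then have "\<bar>energy_gap m a t\<bar> * \<bar>?s\<bar> = \<bar>a\<bar> * \<bar>2 * t + a\<bar>"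
    by (simp only: abs_mult[symmetric])
  then have "\<bar>energy_gap m a t\<bar> * ?s = a * \<bar>2 * t + a\<bar>"
    using a s by simp
  also have "\<dots> < a * ?s"
    using a s by (intro mult_strict_left_mono) auto
  finally have "\<bar>energy_gap m a t\<bar> * ?s < a * ?s" .
  moreover have "0 < ?s" using s by linarith
  ultimately show ?thesis by (simp only: mult_less_cancel_right_pos)
qed

lemma has_field_derivative_energy_gap:
  "(energy_gap m a has_field_derivative
     (a * slice_energy m t - t * energy_gap m a t) / (slice_energy m t * slice_energy m (t + a))) (at t)"
proof -
  have "(energy_gap m a has_field_derivative
     (t + a) / slice_energy m (t + a) - t / slice_energy m t) (at t)"
    unfolding energy_gap_def[abs_def]
    by (intro DERIV_diff has_field_derivative_slice_energy DERIV_chain2[OF has_field_derivative_slice_energy, THEN DERIV_cong])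
      (auto intro!: derivative_eq_intros)
  moreover have "(t + a) / slice_energy m (t + a) - t / slice_energy m t =
      (a * slice_energy m t - t * energy_gap m a t) / (slice_energy m t * slice_energy m (t + a))"
    using slice_energy_pos[of t] slice_energy_pos[of "t + a"]
    by (simp add: energy_gap_def field_simps)
  ultimately show ?thesis by simp
qed

lemma energy_gap_deriv_pos:
  "0 < (a * slice_energy m t - t * energy_gap m a t) / (slice_energy m t * slice_energy m (t + a))"
  using gap_denominator_pos[OF abs_energy_gap_less] slice_energy_pos by simp

lemma inj_energy_gap: "inj (energy_gap m a)"
proof -
  have "strict_mono (energy_gap m a)"
    by (rule strict_monoI, rule DERIV_pos_imp_increasing)
      (use has_field_derivative_energy_gap energy_gap_deriv_pos in blast)+
  then show ?thesis by (rule strict_mono_imp_inj_on)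
qed

lemma gap_inv_energy_gap: "gap_inv m a (energy_gap m a t) = t"
  using energy_gap_gap_inv[OF abs_energy_gap_less] inj_energy_gap by (metis injD)

lemma energy_gap_eq_iff: "energy_gap m a t = h \<longleftrightarrow> \<bar>h\<bar> < a \<and> t = gap_inv m a h"
  using energy_gap_gap_inv abs_energy_gap_less gap_inv_energy_gap by metis

lemma range_energy_gap: "range (energy_gap m a) = {- a<..<a}"
proof -
  have "h \<in> range (energy_gap m a) \<longleftrightarrow> \<bar>h\<bar> < a" for h
    using energy_gap_eq_iff by (metis rangeE rangeI)
  then show ?thesis by (intro set_eqI) (simp only: greaterThanLessThan_iff abs_less_iff, linarith)
qed

lemma gap_jac_energy_gap:
  "(a * slice_energy m t - t * energy_gap m a t) / (slice_energy m t * slice_energy m (t + a))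
     * gap_jac m a (energy_gap m a t) = 1"
  using gap_denominator_pos[OF abs_energy_gap_less] slice_energy_pos[of t] slice_energy_pos[of "t + a"]
  by (simp add: gap_jac_def gap_inv_energy_gap)
    (smt (verit) divide_eq_eq_1 gap_denominator_pos abs_energy_gap_less nonzero_divide_eq_eq)

text \<open>\<open>G\<close> takes the position \<open>t\<close> and the gap value as separate
  arguments, since in the mollified integral the test function depends on the position and the
  mollifier on the gap.\<close>

lemma nn_integral_energy_gap:
  fixes G :: "real \<Rightarrow> real \<Rightarrow> real"
  assumes G: "case_prod G \<in> borel_measurable borel" and nonneg: "\<And>t h. 0 \<le> G t h"
  shows "(\<integral>\<^sup>+t. ennreal (G t (energy_gap m a t)) \<partial>lborel) =
    (\<integral>\<^sup>+h. ennreal (G (gap_inv m a h) h * gap_jac m a h) * indicator {- a<..<a} h \<partial>lborel)"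
proof -
  let ?D = "\<lambda>t. (a * slice_energy m t - t * energy_gap m a t) / (slice_energy m t * slice_energy m (t + a))"
  \<comment> \<open>The change of variables requires a function that is nonnegative everywhere;
    outside the open interval the sign of \<open>gap_jac\<close> is not controlled, so the indicator
    is built in.\<close>
  define f where "f h = G (gap_inv m a h) h * gap_jac m a h * indicator {- a<..<a} h" for h
  have [measurable]: "(\<lambda>x. G (u x) (v x)) \<in> borel_measurable borel"
    if [measurable]: "u \<in> borel_measurable borel" "v \<in> borel_measurable borel" for u v :: "real \<Rightarrow> real"
    using measurable_compose[OF borel_measurable_Pair[OF that] G] by simp
  have f: "f (energy_gap m a t) * ?D t = G t (energy_gap m a t)" for t
  proof -
    have "energy_gap m a t \<in> {- a<..<a}" using abs_energy_gap_less[of t] by (auto simp: abs_less_iff)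
    then have "f (energy_gap m a t) * ?D t =
        G t (energy_gap m a t) * (?D t * gap_jac m a (energy_gap m a t))"
      by (simp add: f_def gap_inv_energy_gap)
    then show ?thesis unfolding gap_jac_energy_gap by simp
  qed
  have fD: "\<bar>?D t\<bar> * f (energy_gap m a t) = G t (energy_gap m a t)" for t
    using f[of t] energy_gap_deriv_pos[of t] by (simp only: abs_of_pos mult.commute)
  have "(\<integral>\<^sup>+h. ennreal (f h) * indicator (range (energy_gap m a)) h \<partial>lborel) =
      (\<integral>\<^sup>+t. ennreal (\<bar>?D t\<bar> * f (energy_gap m a t)) \<partial>lborel)"
  proof (rule nn_integral_change_of_variables_real[OF has_field_derivative_energy_gap inj_energy_gap])
    fix h
    show "0 \<le> f h"
    proof (cases "\<bar>h\<bar> < a")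
      case True
      then show ?thesis using gap_jac_pos[OF True] nonneg by (simp add: f_def)
    qed (auto simp: f_def abs_less_iff)
  qed (unfold fD range_energy_gap f_def, measurable)
  also have "\<dots> = (\<integral>\<^sup>+t. ennreal (G t (energy_gap m a t)) \<partial>lborel)"
    unfolding fD ..
  also have "(\<integral>\<^sup>+h. ennreal (f h) * indicator (range (energy_gap m a)) h \<partial>lborel) =
      (\<integral>\<^sup>+h. ennreal (G (gap_inv m a h) h * gap_jac m a h) * indicator {- a<..<a} h \<partial>lborel)"
    by (intro nn_integral_cong) (simp add: f_def range_energy_gap indicator_def)
  finally show ?thesis by simp
qed

end

end

section \<open>The collision surface\<close>

lemma energy_sq: "(energy p)\<^sup>2 = 1 + (norm p)\<^sup>2"
  by (simp add: energy_def)

lemma norm_less_energy: "norm p < energy p"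
  by (simp add: energy_def real_less_rsqrt)

lemma energy_pos: "0 < energy p"
  using norm_less_energy[of p] norm_ge_zero[of p] by linarith

lemma continuous_on_energy [continuous_intros]:
  "continuous_on S f \<Longrightarrow> continuous_on S (\<lambda>z. energy (f z))"
  unfolding energy_def by (intro continuous_intros)

lemma borel_measurable_energy [measurable]: "energy \<in> borel_measurable borel"
  by (intro borel_measurable_continuous_onI continuous_on_energy continuous_on_id)

lemma energy_coord: "energy (coord x y t) = slice_energy (1 + (norm y)\<^sup>2) t"
  by (simp add: energy_def slice_energy_def norm_coord)

lemma energy_coord_shift: "energy (coord x y t + x) = slice_energy (1 + (norm y)\<^sup>2) (t + norm x)"
  by (simp add: energy_def slice_energy_def norm_coord_shift)

text \<open>The energy times itself minus the norm times itself is constant, and the energy strictly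
  exceeds the norm, so energies differ by less than norms do. For \<open>x = p' - p\<close> this
  places the required gap inside the range of \<open>energy_gap\<close>, and the collision surface
  is a full graph for every \<open>p\<close>.\<close>

lemma abs_energy_diff_less:
  assumes "x \<noteq> 0"
  shows "\<bar>energy (p + x) - energy p\<bar> < norm x"
proof -
  let ?s = "energy (p + x) + energy p" and ?n = "norm (p + x) + norm p"
  have s: "?n < ?s" using norm_less_energy[of p] norm_less_energy[of "p + x"] by linarith
  then have pos: "0 < ?s" using norm_ge_zero[of p] norm_ge_zero[of "p + x"] by linarith
  have "(energy (p + x) - energy p) * ?s = (norm (p + x) - norm p) * ?n"
    using energy_sq[of p] energy_sq[of "p + x"] by (simp add: power2_eq_square algebra_simps)
  then have "\<bar>energy (p + x) - energy p\<bar> * \<bar>?s\<bar> = \<bar>norm (p + x) - norm p\<bar> * \<bar>?n\<bar>"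
    by (simp only: abs_mult[symmetric])
  then have "\<bar>energy (p + x) - energy p\<bar> * ?s = \<bar>norm (p + x) - norm p\<bar> * ?n"
    using pos by simp
  also have "\<dots> \<le> norm x * ?n"
    using norm_triangle_ineq3[of "p + x" p] by (intro mult_right_mono) auto
  also have "\<dots> < norm x * ?s"
    using s assms by (intro mult_strict_left_mono) auto
  finally have "\<bar>energy (p + x) - energy p\<bar> * ?s < norm x * ?s" .
  then show ?thesis using pos by (simp only: mult_less_cancel_right_pos)
qed

text \<open>Here \<open>q\<close> plays the role of \<open>q'\<close>. With \<open>c\<close> the gap
  at \<open>p\<close>, the difference \<open>(energy q + c)^2 - (energy (q + x))^2\<close> is -2
  times the Lorentz product. It factors, and the factor \<open>energy q + c + energy (q + x)\<close>
  is positive, so the root of the wrong sign is excluded.\<close>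

lemma collision_surface_iff:
  "lorentz (four_mom (p + x) - four_mom p) (four_mom q - four_mom p) = 0 \<longleftrightarrow>
    energy (q + x) - energy q = energy (p + x) - energy p"
    (is "?l = 0 \<longleftrightarrow> _")
proof -
  define c where "c = energy (p + x) - energy p"
  have c: "\<bar>c\<bar> \<le> norm x"
    using abs_energy_diff_less[of x p] by (cases "x = 0") (auto simp: c_def)
  have "norm x \<le> norm (q + x) + norm q"
    by (metis add_diff_cancel_left' norm_triangle_ineq4)
  then have pos: "0 < energy q + c + energy (q + x)"
    using c norm_less_energy[of q] norm_less_energy[of "q + x"] by linarith
  have e: "energy (p + x) = energy p + c" by (simp add: c_def)
  have l: "?l = - (c * (energy q - energy p)) + x \<bullet> (q - p)"
    by (simp add: lorentz_def four_mom_def c_def)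
  have "(energy q + c)\<^sup>2 - (energy (q + x))\<^sup>2 = - 2 * ?l"
  proof -
    have "(energy p + c)\<^sup>2 = 1 + (norm (p + x))\<^sup>2" using energy_sq[of "p + x"] e by simp
    moreover have "(norm (v + x))\<^sup>2 = (norm v)\<^sup>2 + 2 * (x \<bullet> v) + (norm x)\<^sup>2" for v
      by (simp add: power2_norm_eq_inner inner_add_left inner_add_right inner_commute)
    ultimately show ?thesis
      unfolding l using energy_sq[of p] energy_sq[of q] energy_sq[of "q + x"]
      by (simp add: inner_diff_right power2_sum algebra_simps)
  qed
  then have "(energy q + c - energy (q + x)) * (energy q + c + energy (q + x)) = - 2 * ?l"
    by (simp add: power2_eq_square algebra_simps)
  then have "?l = 0 \<longleftrightarrow> energy q + c - energy (q + x) = 0"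
    using pos by auto
  then show ?thesis unfolding c_def by linarith
qed

section \<open>The global chart of the collision surface and its area element\<close>

lemma ex_coord: "\<exists>y t. q = coord x y t"
proof -
  define w where "w = frame x q"
  have "w = emb (vector [w $ 1, w $ 2]) (w $ 3)"
    by (simp add: vec_eq_iff forall_3)
  then have "q = coord x (vector [w $ 1, w $ 2]) (w $ 3)"
    using frame_frame[of x q] unfolding coord_def w_def by metis
  then show ?thesis by blast
qed

definition chart :: "real ^ 3 \<Rightarrow> real \<Rightarrow> real ^ 2 \<Rightarrow> real ^ 3" where
  "chart x c y = coord x y (gap_inv (1 + (norm y)\<^sup>2) (norm x) c)"

lemma borel_measurable_chart [measurable (raw)]:
  assumes [measurable]: "f \<in> borel_measurable M" "g \<in> borel_measurable M" "h \<in> borel_measurable M"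
  shows "(\<lambda>z. chart (f z) (g z) (h z)) \<in> borel_measurable M"
  unfolding chart_def by measurable

lemma one_plus_norm_sq_pos: "0 < 1 + (norm (y :: 'a::real_normed_vector))\<^sup>2"
  by (simp add: add_pos_nonneg)

lemma range_chart:
  assumes x: "x \<noteq> 0" and c: "\<bar>c\<bar> < norm x"
  shows "range (chart x c) = {q. energy (q + x) - energy q = c}"
proof (rule set_eqI)
  fix q
  have gap: "energy (coord x y t + x) - energy (coord x y t) = c \<longleftrightarrow>
      t = gap_inv (1 + (norm y)\<^sup>2) (norm x) c" for y t
    using energy_gap_eq_iff[OF one_plus_norm_sq_pos[of y], of "norm x" t c] x c
    by (simp add: energy_coord energy_coord_shift energy_gap_def)
  obtain y t where q: "q = coord x y t" using ex_coord by blast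
  show "q \<in> range (chart x c) \<longleftrightarrow> q \<in> {q. energy (q + x) - energy q = c}"
  proof
    assume "q \<in> range (chart x c)"
    then obtain z where "q = coord x z (gap_inv (1 + (norm z)\<^sup>2) (norm x) c)"
      by (auto simp: chart_def)
    then show "q \<in> {q. energy (q + x) - energy q = c}"
      using gap[of z "gap_inv (1 + (norm z)\<^sup>2) (norm x) c"] by simp
  next
    assume "q \<in> {q. energy (q + x) - energy q = c}"
    then have "q = chart x c y" using gap[of y t] q by (simp add: chart_def)
    then show "q \<in> range (chart x c)" by simp
  qed
qed

text \<open>The gradient in \<open>y\<close> of the height
  \<open>gap_inv (1 + (norm y)^2) (norm x) c\<close> is \<open>chart_slope x c y\<close> times
  \<open>y\<close>.\<close>

definition chart_slope :: "real ^ 3 \<Rightarrow> real \<Rightarrow> real ^ 2 \<Rightarrow> real" where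
  "chart_slope x c y = c / norm x / ((1 - (c / norm x)\<^sup>2) * mid_energy (1 + (norm y)\<^sup>2) (norm x) c)"

lemma linear_emb: "linear (\<lambda>(y, t). emb y t)"
  by (rule linearI) (auto simp: vec_eq_iff forall_3)

lemma bounded_linear_coord: "bounded_linear (\<lambda>(y, t). coord x y t)"
proof -
  have "(\<lambda>(y, t). coord x y t) = frame x \<circ> (\<lambda>(y, t). emb y t)"
    by (auto simp: fun_eq_iff coord_def)
  then show ?thesis
    using linear_compose[OF linear_emb linear_frame[of x]] by (simp add: linear_conv_bounded_linear)
qed

text \<open>Since \<open>frame x\<close> is an involution, applying it and dropping the axial entry
  recovers \<open>y\<close>. This is the linear left inverse of the chart demanded by
  \<open>surface_measure_global_chart\<close>.\<close>

lemma coord_inverse: "bounded_linear (\<lambda>q. vector [frame x q $ 1, frame x q $ 2] :: real ^ 2)"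
  and coord_inverse_coord: "(vector [frame x (coord x y t) $ 1, frame x (coord x y t) $ 2] :: real ^ 2) = y"
proof -
  have "linear (\<lambda>q. vector [frame x q $ 1, frame x q $ 2] :: real ^ 2)"
    by (rule linearI) (simp_all add: vec_eq_iff forall_2 linear_add[OF linear_frame] linear_cmul[OF linear_frame])
  then show "bounded_linear (\<lambda>q. vector [frame x q $ 1, frame x q $ 2] :: real ^ 2)"
    by (simp add: linear_conv_bounded_linear)
  show "(vector [frame x (coord x y t) $ 1, frame x (coord x y t) $ 2] :: real ^ 2) = y"
    by (simp add: coord_def vec_eq_iff forall_2)
qed

lemma has_derivative_chart:
  assumes x: "x \<noteq> 0" and c: "\<bar>c\<bar> < norm x"
  shows "(chart x c has_derivative (\<lambda>v. coord x v (chart_slope x c y * (y \<bullet> v)))) (at y)"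
proof -
  define a k where "a = norm x" and "k = c / a"
  define k' where "k' = 1 - k\<^sup>2"
  have a: "0 < a" using x by (simp add: a_def)
  have k: "0 < 1 - k\<^sup>2" using one_minus_ratio_pos[of 1 a c] a c by (simp add: a_def k_def)
  have R: "0 < mid_energy (1 + (norm y)\<^sup>2) a c"
    using mid_energy_pos[OF one_plus_norm_sq_pos a] c by (simp add: a_def)
  then have pos: "0 < (1 + y \<bullet> y) / (1 - k\<^sup>2) + a\<^sup>2 / 4"
    by (simp add: mid_energy_def k_def power2_norm_eq_inner)
  \<comment> \<open>The squared norm is written as \<open>z \<bullet> z\<close>, because the norm
    itself is not differentiable at 0.\<close>
  have "((\<lambda>z. k * sqrt ((1 + z \<bullet> z) / (1 - k\<^sup>2) + a\<^sup>2 / 4) - a / 2) has_derivative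
      (\<lambda>v. k * (inverse (sqrt ((1 + y \<bullet> y) / (1 - k\<^sup>2) + a\<^sup>2 / 4)) / 2 * ((2 * (y \<bullet> v)) / (1 - k\<^sup>2))))) (at y)"
    using k pos unfolding k'_def[symmetric] by (auto intro!: derivative_eq_intros simp: inner_commute fun_eq_iff)
  moreover have "(\<lambda>z :: real ^ 2. k * sqrt ((1 + z \<bullet> z) / (1 - k\<^sup>2) + a\<^sup>2 / 4) - a / 2) =
      (\<lambda>z. gap_inv (1 + (norm z)\<^sup>2) a c)"
    by (simp add: gap_inv_def mid_energy_def k_def power2_norm_eq_inner)
  moreover have "k * (inverse (sqrt ((1 + y \<bullet> y) / (1 - k\<^sup>2) + a\<^sup>2 / 4)) / 2 * ((2 * (y \<bullet> v)) / (1 - k\<^sup>2)))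
      = chart_slope x c y * (y \<bullet> v)" for v
  proof -
    have "k * (inverse S / 2 * (2 * X / A)) = k / (A * S) * X" for S X A :: real
      by (simp add: field_simps)
    then show ?thesis
      unfolding chart_slope_def a_def[symmetric] k_def[symmetric] mid_energy_def power2_norm_eq_inner .
  qed
  ultimately have "((\<lambda>z. gap_inv (1 + (norm z)\<^sup>2) a c) has_derivative (\<lambda>v. chart_slope x c y * (y \<bullet> v))) (at y)"
    by (simp only:)
  from bounded_linear.has_derivative[OF bounded_linear_coord has_derivative_Pair[OF has_derivative_ident this], of x]
  show ?thesis by (simp add: chart_def[abs_def] a_def)
qed

text \<open>Lagrange's identity:
  \<open>(1 + s^2) * (1 + t^2) - (s * t)^2 = 1 + s^2 + t^2\<close>.\<close>

lemma norm_cross3_coord: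
  "norm (cross3 (coord x (axis 1 1) s) (coord x (axis 2 1) t)) = sqrt (1 + s\<^sup>2 + t\<^sup>2)"
proof -
  let ?u = "coord x (axis 1 1) s" and ?v = "coord x (axis 2 1) t"
  have n: "(norm ?u)\<^sup>2 = 1 + s\<^sup>2" "(norm ?v)\<^sup>2 = 1 + t\<^sup>2"
    by (simp_all add: norm_coord)
  have i: "?u \<bullet> ?v = s * t"
    by (simp add: coord_def) (simp add: inner_vec_def sum_3 axis_def)
  have "(norm (cross3 ?u ?v))\<^sup>2 = 1 + s\<^sup>2 + t\<^sup>2"
    using norm_cross_dot[of ?u ?v] unfolding power_mult_distrib n i
    by (simp add: algebra_simps power2_eq_square)
  then show ?thesis by (metis norm_ge_zero real_sqrt_unique)
qed

text \<open>At \<open>q\<close> on the surface the gradient of the gap is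
  \<open>(q + x) / energy (q + x) - q / energy q\<close>, which is the vector under the norm divided
  by \<open>- energy (q + x)\<close>. As \<open>gap_jac\<close> is the reciprocal of the axial
  derivative of the gap, the right side is the usual area element of an implicit graph: length of
  the gradient over the axial derivative.\<close>

lemma area_element_chart:
  assumes x: "x \<noteq> 0" and c: "\<bar>c\<bar> < norm x"
  defines "q y \<equiv> chart x c y"
  shows "norm (cross3 (coord x (axis 1 1) (chart_slope x c y * (y \<bullet> axis 1 1)))
      (coord x (axis 2 1) (chart_slope x c y * (y \<bullet> axis 2 1)))) =
    norm ((c / energy (q y)) *\<^sub>R q y - x) * gap_jac (1 + (norm y)\<^sup>2) (norm x) c / energy (q y + x)"
proof -
  \<comment> \<open>\<open>- w\<close> is the axial component of the vector under the norm, whose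
    transverse part has length |c / e| times \<open>norm y\<close>; moreover \<open>e * w\<close> is
    the denominator of \<open>gap_jac\<close>.\<close>
  define a m t e e' b w where "a = norm x" and "m = 1 + (norm y)\<^sup>2" and "t = gap_inv m a c"
    and "e = slice_energy m t" and "e' = slice_energy m (t + a)" and "b = chart_slope x c y"
    and "w = a - c * t / e"
  have a: "0 < a" and ca: "\<bar>c\<bar> < a" using x c by (auto simp: a_def)
  have m: "0 < m" using one_plus_norm_sq_pos by (simp add: m_def)
  have q: "q y = coord x y t" by (simp add: q_def chart_def t_def m_def a_def)
  have e: "energy (q y) = e" "energy (q y + x) = e'"
    unfolding q by (simp_all add: energy_coord energy_coord_shift e_def e'_def m_def a_def)
  have pos: "0 < e" "0 < e'" using slice_energy_pos[OF m] by (auto simp: e_def e'_def)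
  have den: "0 < a * e - t * c"
    using gap_denominator_pos[OF m a ca] by (simp add: e_def)
  have ew: "a * e - t * c = e * w" using pos by (simp add: w_def field_simps)
  then have w: "0 < w" using den pos by (simp add: zero_less_mult_iff)
  have b: "b = c / (e * w)"
  proof -
    have "a * e - t * c = a * (1 - (c / a)\<^sup>2) * mid_energy m a c"
      using gap_denominator_eq[OF m a ca] by (simp add: e_def t_def)
    then show ?thesis
      unfolding ew[symmetric] by (simp add: b_def chart_slope_def a_def m_def)
  qed
  have cb: "c / e = b * w" using b w pos by (simp add: field_simps)
  have "(norm ((c / e) *\<^sub>R q y - x))\<^sup>2 = (c / e)\<^sup>2 * (norm (q y))\<^sup>2 - 2 * (c / e) * (x \<bullet> q y) + a\<^sup>2"
    unfolding a_def power2_norm_eq_inner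
    by (simp add: inner_diff_left inner_diff_right inner_commute power2_eq_square algebra_simps)
  also have "x \<bullet> q y = a * t"
    unfolding q coord_def inner_frame_right by (simp add: a_def)
  also have "(norm (q y))\<^sup>2 = (norm y)\<^sup>2 + t\<^sup>2"
    unfolding q by (rule norm_coord)
  also have "(c / e)\<^sup>2 * ((norm y)\<^sup>2 + t\<^sup>2) - 2 * (c / e) * (a * t) + a\<^sup>2 = (c / e)\<^sup>2 * (norm y)\<^sup>2 + w\<^sup>2"
    by (simp add: w_def power2_eq_square algebra_simps)
  also have "(c / e)\<^sup>2 * (norm y)\<^sup>2 + w\<^sup>2 = w\<^sup>2 * (1 + (b * y $ 1)\<^sup>2 + (b * y $ 2)\<^sup>2)"
    unfolding cb norm_vec2 by (simp add: power2_eq_square algebra_simps)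
  finally have "norm ((c / e) *\<^sub>R q y - x) = sqrt (w\<^sup>2 * (1 + (b * y $ 1)\<^sup>2 + (b * y $ 2)\<^sup>2))"
    by (intro real_sqrt_unique[symmetric]) auto
  also have "\<dots> = w * sqrt (1 + (b * y $ 1)\<^sup>2 + (b * y $ 2)\<^sup>2)"
    using w by (simp add: real_sqrt_mult)
  finally have "norm ((c / e) *\<^sub>R q y - x) = w * sqrt (1 + (b * y $ 1)\<^sup>2 + (b * y $ 2)\<^sup>2)" .
  moreover have "gap_jac m a c = e' / w"
    using pos w unfolding gap_jac_def t_def[symmetric] e_def[symmetric] e'_def[symmetric] ew by simp
  ultimately have "norm ((c / e) *\<^sub>R q y - x) * gap_jac m a c / e' = sqrt (1 + (b * y $ 1)\<^sup>2 + (b * y $ 2)\<^sup>2)"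
    using pos w by simp
  then show ?thesis
    unfolding norm_cross3_coord e by (simp add: inner_axis b_def m_def a_def)
qed

lemma regular_patch_chart:
  assumes x: "x \<noteq> 0" and c: "\<bar>c\<bar> < norm x"
  shows "regular_patch UNIV (chart x c) (\<lambda>y v. coord x v (chart_slope x c y * (y \<bullet> v)))"
  unfolding regular_patch_def
proof (intro conjI ballI allI)
  show "inj (chart x c)"
    by (rule injI) (metis chart_def coord_inverse_coord)
  fix i :: 2
  have "continuous_on UNIV (\<lambda>y. chart_slope x c y)"
  proof -
    have "mid_energy (1 + (norm y)\<^sup>2) (norm x) c \<noteq> 0" for y :: "real ^ 2"
      using mid_energy_pos[OF one_plus_norm_sq_pos[of y] _ c] x by simp
    moreover have "1 - (c / norm x)\<^sup>2 \<noteq> 0"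
      using one_minus_ratio_pos[of 1 "norm x" c] x c by simp
    ultimately show ?thesis
      unfolding chart_slope_def[abs_def] mid_energy_def
      by (intro continuous_intros) auto
  qed
  then have "continuous_on UNIV (\<lambda>y. (\<lambda>(y, t). coord x y t) (axis i 1, chart_slope x c y * (y \<bullet> axis i 1)))"
    by (intro continuous_on_compose2[OF linear_continuous_on[OF bounded_linear_coord[of x], of UNIV]] continuous_intros) auto
  then show "continuous_on UNIV (\<lambda>y. coord x (axis i 1) (chart_slope x c y * (y \<bullet> axis i 1)))"
    by simp
next
  fix y
  show "cross3 (coord x (axis 1 1) (chart_slope x c y * (y \<bullet> axis 1 1)))
      (coord x (axis 2 1) (chart_slope x c y * (y \<bullet> axis 2 1))) \<noteq> 0"
    using norm_cross3_coord[of x "chart_slope x c y * (y \<bullet> axis 1 1)" "chart_slope x c y * (y \<bullet> axis 2 1)"]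
    by (metis add_pos_nonneg add_pos_pos less_irrefl norm_zero real_sqrt_gt_zero zero_le_power2 zero_less_one)
qed (use has_derivative_chart[OF x c] in auto)

lemma nn_integral_collision_surface:
  fixes p :: "real ^ 3"
  assumes x: "x \<noteq> 0" and F: "F \<in> borel_measurable borel"
  defines "c \<equiv> energy (p + x) - energy p"
  shows "(\<integral>\<^sup>+q. F q \<partial>surface_measure {q. lorentz (four_mom (p + x) - four_mom p) (four_mom q - four_mom p) = 0})
    = (\<integral>\<^sup>+y. ennreal (norm ((c / energy (chart x c y)) *\<^sub>R chart x c y - x) *
        gap_jac (1 + (norm y)\<^sup>2) (norm x) c / energy (chart x c y + x)) * F (chart x c y) \<partial>lborel)"
proof -
  let ?S = "{q. lorentz (four_mom (p + x) - four_mom p) (four_mom q - four_mom p) = 0}"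
  have c: "\<bar>c\<bar> < norm x" unfolding c_def by (rule abs_energy_diff_less[OF x])
  have S: "?S = {q. energy (q + x) - energy q = c}"
    by (simp add: collision_surface_iff c_def)
  have range: "range (chart x c) = ?S" unfolding S by (rule range_chart[OF x c])
  have "closed ?S"
    unfolding S by (intro closed_Collect_eq continuous_intros)
  then have "?S \<in> sets borel" by simp
  have sm: "surface_measure ?S = distr (density lborel (\<lambda>y. ennreal (norm
      (cross3 (coord x (axis 1 1) (chart_slope x c y * (y \<bullet> axis 1 1)))
        (coord x (axis 2 1) (chart_slope x c y * (y \<bullet> axis 2 1))))))) borel (chart x c)"
    by (rule surface_measure_global_chart[OF regular_patch_chart[OF x c] range \<open>?S \<in> sets borel\<close> coord_inverse[of x]])
      (simp add: chart_def coord_inverse_coord)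
  have [measurable]: "chart x c \<in> borel_measurable borel" "F \<in> borel_measurable borel"
    using borel_measurable_chart[of "\<lambda>_. x" borel "\<lambda>_. c" "\<lambda>y. y"] F by auto
  show ?thesis
    unfolding sm area_element_chart[OF x c]
    by (subst nn_integral_distr, simp, simp, subst nn_integral_density) simp_all
qed

section \<open>Uniqueness of the Dirac delta of a map\<close>

lemma test_fun_borel_measurable: "test_fun \<psi> \<Longrightarrow> \<psi> \<in> borel_measurable borel"
  by (simp add: test_fun_def borel_measurable_continuous_onI)

lemma test_fun_support:
  assumes "test_fun \<psi>"
  obtains R where "0 < R" "\<And>z. \<psi> z \<noteq> 0 \<Longrightarrow> norm z \<le> R"
proof -
  have "bounded {z. \<psi> z \<noteq> 0}" using assms by (simp add: test_fun_def)
  then show ?thesis using that by (auto simp: bounded_pos)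
qed

lemma test_fun_bounded:
  assumes \<psi>: "test_fun \<psi>"
  obtains M where "0 < M" "\<And>z. \<bar>\<psi> z\<bar> \<le> M"
proof -
  obtain R where R: "\<And>z. \<psi> z \<noteq> 0 \<Longrightarrow> norm z \<le> R" using test_fun_support[OF \<psi>] by blast
  have "compact (\<psi> ` cball 0 R)"
    using \<psi> by (intro compact_continuous_image) (auto simp: test_fun_def intro: continuous_on_subset)
  then obtain M where M: "0 < M" "\<And>z. z \<in> cball 0 R \<Longrightarrow> \<bar>\<psi> z\<bar> \<le> M"
    using compact_imp_bounded[of "\<psi> ` cball 0 R"] by (auto simp: bounded_pos)
  have "\<bar>\<psi> z\<bar> \<le> M" for z
    using M R[of z] by (cases "\<psi> z = 0") auto
  with M that show ?thesis by blast
qed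

lemma test_fun_integrable:
  assumes \<psi>: "test_fun \<psi>" and sets: "sets \<mu> = sets borel"
    and fin: "\<And>K. compact K \<Longrightarrow> emeasure \<mu> K < \<infinity>"
  shows "integrable \<mu> \<psi>"
proof -
  obtain R where R: "\<And>z. \<psi> z \<noteq> 0 \<Longrightarrow> norm z \<le> R" using test_fun_support[OF \<psi>] by blast
  obtain M where M: "0 < M" "\<And>z. \<bar>\<psi> z\<bar> \<le> M" using test_fun_bounded[OF \<psi>] by blast
  have [measurable]: "\<psi> \<in> borel_measurable \<mu>"
    using test_fun_borel_measurable[OF \<psi>] sets by (simp cong: measurable_cong_sets)
  have B: "cball 0 R \<in> sets \<mu>" using sets by simp
  show ?thesis
  proof (rule Bochner_Integration.integrable_bound)
    show "integrable \<mu> (\<lambda>z. M * indicator (cball 0 R) z)"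
      using B fin[of "cball 0 R"] by (intro integrable_mult_right integrable_real_indicator) auto
    show "AE z in \<mu>. norm (\<psi> z) \<le> norm (M * indicator (cball 0 R) z)"
      using R M by (intro AE_I2) (auto simp: indicator_def)
  qed simp
qed

text \<open>Uniqueness of limits can identify two candidate delta measures only if there is some
  mollifier to test with. A normalized cone serves.\<close>

lemma ex_mollifier: "\<exists>\<eta> :: 'b::euclidean_space \<Rightarrow> real. mollifier \<eta>"
proof -
  define f :: "'b \<Rightarrow> real" where "f y = max 0 (1 - norm y)" for y
  have f: "test_fun f"
    unfolding test_fun_def
  proof
    show "continuous_on UNIV f" unfolding f_def by (intro continuous_intros)
    show "bounded {y. f y \<noteq> 0}"
      by (rule bounded_subset[OF bounded_cball[of 0 1]]) (auto simp: f_def max_def split: if_splits)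
  qed
  have int: "integrable lborel f"
    by (rule test_fun_integrable[OF f _ emeasure_compact_finite]) simp
  have "0 < measure lborel (cball (0 :: 'b) (1 / 2)) / 2"
    by (simp add: content_cball_pos)
  also have "\<dots> = (\<integral>y. 1 / 2 * indicator (cball (0 :: 'b) (1 / 2)) y \<partial>lborel)"
    by simp
  also have "\<dots> \<le> (\<integral>y. f y \<partial>lborel)"
  proof (rule integral_mono[OF _ int])
    show "integrable lborel (\<lambda>y. 1 / 2 * indicator (cball (0 :: 'b) (1 / 2)) y :: real)"
      by (intro integrable_mult_right integrable_real_indicator)
        (use emeasure_compact_finite[of "cball (0 :: 'b) (1 / 2)"] in simp_all)
  qed (auto simp: f_def indicator_def)
  finally have pos: "0 < (\<integral>y. f y \<partial>lborel)" .
  define I where "I = (\<integral>y. f y \<partial>lborel)"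
  have I: "0 < I" using pos by (simp add: I_def)
  have "{y. f y / I \<noteq> 0} = {y. f y \<noteq> 0}" using I by auto
  then have "test_fun (\<lambda>y. f y / I)"
    using f I unfolding test_fun_def by (auto intro!: continuous_on_divide continuous_on_const)
  moreover have "0 \<le> f y / I" for y using I by (simp add: f_def)
  moreover have "(\<integral>y. f y / I \<partial>lborel) = 1" using I by (simp flip: I_def)
  ultimately have "mollifier (\<lambda>y. f y / I)" unfolding mollifier_def by blast
  then show ?thesis by blast
qed

text \<open>Continuous cutoffs supported in an open box increase to its indicator, so test functions
  determine the measure of every box; boxes are stable under intersection and generate the Borel
  sets.\<close>

lemma measure_eqI_test_fun:
  fixes \<mu> \<nu> :: "'a::euclidean_space measure"
  assumes sets: "sets \<mu> = sets borel" "sets \<nu> = sets borel"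
    and fin: "\<And>K. compact K \<Longrightarrow> emeasure \<mu> K < \<infinity>" "\<And>K. compact K \<Longrightarrow> emeasure \<nu> K < \<infinity>"
    and eq: "\<And>\<psi>. test_fun \<psi> \<Longrightarrow> (\<integral>x. \<psi> x \<partial>\<mu>) = (\<integral>x. \<psi> x \<partial>\<nu>)"
  shows "\<mu> = \<nu>"
proof -
  define \<psi> :: "'a set \<Rightarrow> nat \<Rightarrow> 'a \<Rightarrow> real" where "\<psi> U n x = min 1 (real n * infdist x (- U))" for U n x
  have finbox: "emeasure M (box l u) < \<infinity>"
    if "sets M = sets borel" "\<And>K. compact K \<Longrightarrow> emeasure M K < \<infinity>" for M :: "'a measure" and l u
  proof -
    have "emeasure M (box l u) \<le> emeasure M (cbox l u)"
      using that(1) box_subset_cbox by (intro emeasure_mono) auto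
    also have "\<dots> < \<infinity>" by (rule that(2)) simp
    finally show ?thesis .
  qed
  have test: "test_fun (\<psi> U n)" if "bounded U" for U n
  proof -
    have "bounded {x. \<psi> U n x \<noteq> 0}"
      by (rule bounded_subset[OF that]) (auto simp: \<psi>_def intro: ccontr)
    then show ?thesis
      unfolding test_fun_def \<psi>_def by (auto intro!: continuous_intros)
  qed
  have lim: "(\<lambda>n. \<integral>x. \<psi> (box l u) n x \<partial>M) \<longlonglongrightarrow> measure M (box l u)"
    if M: "sets M = sets borel" "\<And>K. compact K \<Longrightarrow> emeasure M K < \<infinity>" for M :: "'a measure" and l u
  proof -
    let ?U = "box l u"
    have U: "?U \<in> sets M" using M by simp
    \<comment> \<open>The distance \<open>infdist\<close> to the empty set is 0 by convention, so
      the cutoffs reach 1 only because the complement of the box is nonempty.\<close>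
    have ne: "- ?U \<noteq> {}" using bounded_box not_bounded_UNIV by (metis Compl_eq_Diff_UNIV Diff_eq_empty_iff top.extremum_unique)
    have "(\<lambda>n. \<integral>x. \<psi> ?U n x \<partial>M) \<longlonglongrightarrow> (\<integral>x. indicator ?U x \<partial>M)"
    proof (rule integral_dominated_convergence[where w = "indicator ?U"])
      show "(\<lambda>x. indicator ?U x :: real) \<in> borel_measurable M" using U by simp
      show "\<psi> ?U n \<in> borel_measurable M" for n
        using test_fun_borel_measurable[OF test[OF bounded_box]] M by (simp cong: measurable_cong_sets)
      show "integrable M (indicator ?U :: 'a \<Rightarrow> real)"
        using U finbox[OF M] by (intro integrable_real_indicator) auto
      show "AE x in M. norm (\<psi> ?U n x) \<le> indicator ?U x" for n
        by (intro AE_I2) (auto simp: \<psi>_def indicator_def infdist_nonneg)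
      show "AE x in M. (\<lambda>n. \<psi> ?U n x) \<longlonglongrightarrow> indicator ?U x"
      proof (intro AE_I2)
        fix x
        show "(\<lambda>n. \<psi> ?U n x) \<longlonglongrightarrow> indicator ?U x"
        proof (cases "x \<in> ?U")
          case True
          then have "0 < infdist x (- ?U)"
            using infdist_pos_not_in_closed[OF closed_Compl[OF open_box] ne, of x] by simp
          then obtain N where N: "1 < real N * infdist x (- ?U)"
            using reals_Archimedean3 by blast
          have "\<psi> ?U n x = 1" if "N \<le> n" for n
          proof -
            have "real N * infdist x (- ?U) \<le> real n * infdist x (- ?U)"
              using that by (intro mult_right_mono) (auto simp: infdist_nonneg)
            then show ?thesis using N by (simp add: \<psi>_def)
          qed
          then show ?thesis using True
            by (intro tendsto_eventually eventually_sequentiallyI[of N]) auto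
        qed (simp add: \<psi>_def)
      qed
    qed
    then show ?thesis using U by simp
  qed
  have box: "emeasure \<mu> (box l u) = emeasure \<nu> (box l u)" for l u
  proof -
    have "measure \<mu> (box l u) = measure \<nu> (box l u)"
      using lim[OF sets(1) fin(1), of l u] lim[OF sets(2) fin(2), of l u] eq[OF test[OF bounded_box]]
      by (simp add: LIMSEQ_unique)
    then show ?thesis
      using finbox[OF sets(1) fin(1), of l u] finbox[OF sets(2) fin(2), of l u]
      by (simp add: emeasure_eq_ennreal_measure)
  qed
  show ?thesis
  proof (rule measure_eqI_generator_eq)
    let ?E = "range (\<lambda>(a, b). box a b :: 'a set)"
    show "Int_stable ?E" by (auto simp: Int_stable_def box_Int_box)
    show "?E \<subseteq> Pow UNIV" "sets \<mu> = sigma_sets UNIV ?E" "sets \<nu> = sigma_sets UNIV ?E"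
      by (simp_all add: borel_eq_box sets)
    let ?A = "\<lambda>n::nat. box (- (real n *\<^sub>R One)) (real n *\<^sub>R One) :: 'a set"
    show "range ?A \<subseteq> ?E" "(\<Union>i. ?A i) = UNIV" unfolding UN_box_eq_UNIV by auto
    show "emeasure \<mu> (?A i) \<noteq> \<infinity>" for i
      using finbox[OF sets(1) fin(1)] by (metis less_irrefl)
    show "emeasure \<mu> X = emeasure \<nu> X" if "X \<in> ?E" for X using that box by auto
  qed
qed

lemma dirac_delta_eqI:
  fixes \<Phi> :: "'a::euclidean_space \<Rightarrow> 'b::euclidean_space"
  assumes \<mu>: "is_dirac_delta \<Phi> \<mu>"
  shows "dirac_delta \<Phi> = \<mu>"
  unfolding dirac_delta_def
proof (rule the_equality)
  show "is_dirac_delta \<Phi> \<mu>" by (rule \<mu>)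
next
  fix \<nu> assume \<nu>: "is_dirac_delta \<Phi> \<nu>"
  obtain \<eta> :: "'b \<Rightarrow> real" where \<eta>: "mollifier \<eta>" using ex_mollifier by blast
  show "\<nu> = \<mu>"
  proof (rule measure_eqI_test_fun)
    fix \<psi> :: "'a \<Rightarrow> real" assume \<psi>: "test_fun \<psi>"
    show "(\<integral>x. \<psi> x \<partial>\<nu>) = (\<integral>x. \<psi> x \<partial>\<mu>)"
      by (rule tendsto_unique[of "at_right (0 :: real)"
            "\<lambda>\<epsilon>. \<integral>x. \<psi> x * (\<eta> (\<Phi> x /\<^sub>R \<epsilon>) / \<epsilon> ^ DIM('b)) \<partial>lborel"])
        (use \<mu> \<nu> \<eta> \<psi> in \<open>auto simp: is_dirac_delta_def\<close>)
  qed (use \<mu> \<nu> in \<open>auto simp: is_dirac_delta_def\<close>)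
qed

section \<open>Iterated Lebesgue integrals and their measurability\<close>

lemma borel_measurable_fst_comp [measurable (raw)]:
  fixes f :: "'a \<Rightarrow> 'b::second_countable_topology \<times> 'c::second_countable_topology"
  assumes "f \<in> borel_measurable M"
  shows "(\<lambda>x. fst (f x)) \<in> borel_measurable M"
  using measurable_compose[OF assms borel_measurable_continuous_onI[OF continuous_on_fst[OF continuous_on_id]]] by simp

lemma borel_measurable_snd_comp [measurable (raw)]:
  fixes f :: "'a \<Rightarrow> 'b::second_countable_topology \<times> 'c::second_countable_topology"
  assumes "f \<in> borel_measurable M"
  shows "(\<lambda>x. snd (f x)) \<in> borel_measurable M"
  using measurable_compose[OF assms borel_measurable_continuous_onI[OF continuous_on_snd[OF continuous_on_id]]] by simp

lemma nn_integral_lborel_pair: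
  fixes F :: "'a::euclidean_space \<times> 'b::euclidean_space \<Rightarrow> ennreal"
  assumes [measurable]: "F \<in> borel_measurable borel"
  shows "(\<integral>\<^sup>+z. F z \<partial>lborel) = (\<integral>\<^sup>+x. \<integral>\<^sup>+y. F (x, y) \<partial>lborel \<partial>lborel)"
proof -
  have "(\<integral>\<^sup>+z. F z \<partial>lborel) = (\<integral>\<^sup>+z. F z \<partial>(lborel \<Otimes>\<^sub>M lborel))" by (simp add: lborel_prod)
  also have "\<dots> = (\<integral>\<^sup>+x. \<integral>\<^sup>+y. F (x, y) \<partial>lborel \<partial>lborel)"
    by (subst lborel.nn_integral_fst[symmetric]) (auto simp: lborel_prod)
  finally show ?thesis .
qed

lemma nn_integral_lborel_swap:
  fixes F :: "'a::euclidean_space \<Rightarrow> 'b::euclidean_space \<Rightarrow> ennreal"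
  assumes "(\<lambda>z. F (fst z) (snd z)) \<in> borel_measurable borel"
  shows "(\<integral>\<^sup>+x. \<integral>\<^sup>+y. F x y \<partial>lborel \<partial>lborel) = (\<integral>\<^sup>+y. \<integral>\<^sup>+x. F x y \<partial>lborel \<partial>lborel)"
  using assms by (intro lborel_pair.Fubini'[symmetric]) (simp add: lborel_prod case_prod_unfold)

lemma borel_measurable_nn_integral_lborel [measurable (raw)]:
  fixes F :: "'c \<Rightarrow> 'b::euclidean_space \<Rightarrow> ennreal"
  assumes "(\<lambda>z. F (fst z) (snd z)) \<in> borel_measurable (M \<Otimes>\<^sub>M borel)"
  shows "(\<lambda>x. \<integral>\<^sup>+y. F x y \<partial>lborel) \<in> borel_measurable M"
proof -
  have "sets (M \<Otimes>\<^sub>M lborel) = sets (M \<Otimes>\<^sub>M (borel :: 'b measure))"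
    by (rule sets_pair_measure_cong) auto
  then show ?thesis
    using assms by (intro lborel.borel_measurable_nn_integral) (simp add: case_prod_unfold cong: measurable_cong_sets)
qed

lemma nn_integral_affine:
  fixes F :: "'a::euclidean_space \<Rightarrow> ennreal"
  assumes [measurable]: "F \<in> borel_measurable borel" and c: "c \<noteq> 0"
  shows "(\<integral>\<^sup>+x. F x \<partial>lborel) = ennreal (\<bar>c\<bar> ^ DIM('a)) * (\<integral>\<^sup>+x. F (t + c *\<^sub>R x) \<partial>lborel)"
  by (subst lborel_affine[OF c, of t])
    (simp add: nn_integral_density nn_integral_distr nn_integral_cmult)

section \<open>The Dirac delta of the momentum defect\<close>

lemma energy_le: "energy p \<le> 1 + norm p"
proof -
  have "1 + (norm p)\<^sup>2 \<le> (1 + norm p)\<^sup>2" by (simp add: power2_sum)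
  then show ?thesis by (simp add: energy_def real_le_lsqrt)
qed

lemma continuous_on_momentum_defect: "continuous_on UNIV (momentum_defect p)"
  unfolding momentum_defect_def four_mom_def case_prod_unfold by (intro continuous_intros)

lemma isCont_gap_inv:
  assumes a: "0 < a" and h: "\<bar>h\<bar> < a" and m: "0 < m"
  shows "isCont (gap_inv m a) h"
proof -
  have "1 - (h / a)\<^sup>2 \<noteq> 0" using one_minus_ratio_pos[OF m a h] by simp
  then show ?thesis using a unfolding gap_inv_def[abs_def] mid_energy_def
    by (intro continuous_intros) auto
qed

lemma isCont_gap_jac:
  assumes a: "0 < a" and h: "\<bar>h\<bar> < a" and m: "0 < m"
  shows "isCont (gap_jac m a) h"
proof -
  have "a * sqrt (m + (gap_inv m a h)\<^sup>2) - gap_inv m a h * h \<noteq> 0"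
    using gap_denominator_pos[OF m a h, of "gap_inv m a h"] by (simp add: slice_energy_def)
  then show ?thesis
    unfolding gap_jac_def[abs_def] slice_energy_def
    by (intro continuous_intros isCont_gap_inv a h m) auto
qed

text \<open>The zero set of the defect has dimension 9 - 4 = 5, with parameters \<open>x\<close> and
  \<open>y\<close>. Momentum is conserved by the form of the triple, energy by the choice of the
  level in \<open>chart\<close>. The momentum part of the defect contributes determinant 1, so the
  density is the energy Jacobian alone.\<close>

definition collision_measure :: "real ^ 3 \<Rightarrow> ((real ^ 3) \<times> (real ^ 3) \<times> (real ^ 3)) measure" where
  "collision_measure p =
    distr (density lborel (\<lambda>(x, y). ennreal (gap_jac (1 + (norm y)\<^sup>2) (norm x) (energy (p + x) - energy p))))
      borel (\<lambda>(x, y). let q' = chart x (energy (p + x) - energy p) y in (q' + x, q', p + x))"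

lemma nn_integral_collision_measure:
  assumes [measurable]: "F \<in> borel_measurable borel"
  shows "(\<integral>\<^sup>+z. F z \<partial>collision_measure p) = (\<integral>\<^sup>+x. \<integral>\<^sup>+y.
    ennreal (gap_jac (1 + (norm y)\<^sup>2) (norm x) (energy (p + x) - energy p)) *
    F (chart x (energy (p + x) - energy p) y + x, chart x (energy (p + x) - energy p) y, p + x) \<partial>lborel \<partial>lborel)"
proof -
  let ?c = "\<lambda>x. energy (p + x) - energy p"
  let ?J = "\<lambda>z :: (real ^ 3) \<times> (real ^ 2). ennreal (gap_jac (1 + (norm (snd z))\<^sup>2) (norm (fst z)) (?c (fst z)))"
  let ?T = "\<lambda>z :: (real ^ 3) \<times> (real ^ 2). (chart (fst z) (?c (fst z)) (snd z) + fst z,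
    chart (fst z) (?c (fst z)) (snd z), p + fst z)"
  have [measurable]: "?J \<in> borel_measurable borel" "?T \<in> borel_measurable borel" by measurable
  have "(\<integral>\<^sup>+z. F z \<partial>collision_measure p) = (\<integral>\<^sup>+z. F z \<partial>distr (density lborel ?J) borel ?T)"
    by (simp add: collision_measure_def Let_def case_prod_unfold)
  also have "\<dots> = (\<integral>\<^sup>+z. F (?T z) \<partial>density lborel ?J)"
    by (rule nn_integral_distr) simp_all
  also have "\<dots> = (\<integral>\<^sup>+z. ?J z * F (?T z) \<partial>lborel)"
    by (rule nn_integral_density) simp_all
  also have "\<dots> = (\<integral>\<^sup>+x. \<integral>\<^sup>+y. ?J (x, y) * F (?T (x, y)) \<partial>lborel \<partial>lborel)"
    by (rule nn_integral_lborel_pair) measurable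
  finally show ?thesis by simp
qed

text \<open>
  The regularized integrand in the coordinates \<open>q = q' + x\<close>, \<open>p' = p + x - \<epsilon> w\<close>, with \<open>q'\<close> on the
  level set \<open>h = c + \<epsilon> u\<close> of the energy gap; \<open>(u, w)\<close> is the rescaled momentum defect.
\<close>

definition smeared ::
    "real ^ 3 \<Rightarrow> ((real ^ 3) \<times> (real ^ 3) \<times> (real ^ 3) \<Rightarrow> real) \<Rightarrow> (real \<times> (real ^ 3) \<Rightarrow> real) \<Rightarrow> real \<Rightarrow>
      ((real ^ 3) \<times> (real ^ 2)) \<times> (real \<times> (real ^ 3)) \<Rightarrow> real" where
  "smeared p \<psi> \<eta> \<epsilon> = (\<lambda>((x, y), (u, w)).
    let h = energy (p + x - \<epsilon> *\<^sub>R w) - energy p + \<epsilon> * u; q' = chart x h y in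
    if \<bar>h\<bar> < norm x
    then \<psi> (q' + x, q', p + x - \<epsilon> *\<^sub>R w) * \<eta> (u, w) * gap_jac (1 + (norm y)\<^sup>2) (norm x) h else 0)"

lemma borel_measurable_smeared:
  assumes [measurable]: "\<psi> \<in> borel_measurable borel" "\<eta> \<in> borel_measurable borel"
  shows "smeared p \<psi> \<eta> \<epsilon> \<in> borel_measurable borel"
  unfolding smeared_def Let_def case_prod_unfold by measurable

text \<open>At \<epsilon> = 0 the level satisfies the strict inequality |h| < \<open>norm x\<close>,
  so for small \<epsilon> the conditional stays in its first branch, where every factor is
  continuous in \<epsilon>.\<close>

lemma smeared_tendsto:
  assumes \<psi>: "test_fun \<psi>" and x: "x \<noteq> 0"
  shows "((\<lambda>\<epsilon>. smeared p \<psi> \<eta> \<epsilon> ((x, y), (u, w))) \<longlongrightarrow> smeared p \<psi> \<eta> 0 ((x, y), (u, w))) (at_right 0)"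
proof -
  define h where "h \<epsilon> = energy (p + x - \<epsilon> *\<^sub>R w) - energy p + \<epsilon> * u" for \<epsilon>
  define m a where "m = 1 + (norm y)\<^sup>2" and "a = norm x"
  have m: "0 < m" and a: "0 < a" using one_plus_norm_sq_pos x by (auto simp: m_def a_def)
  have h0: "\<bar>h 0\<bar> < a" using abs_energy_diff_less[OF x, of p] by (simp add: h_def a_def)
  have "continuous_on UNIV h" unfolding h_def by (intro continuous_intros)
  then have h: "(h \<longlongrightarrow> h 0) (at_right 0)"
    by (metis UNIV_I continuous_on_def continuous_on_subset subset_UNIV tendsto_within_subset)
  have "((\<lambda>\<epsilon>. \<bar>h \<epsilon>\<bar>) \<longlongrightarrow> \<bar>h 0\<bar>) (at_right 0)" by (intro tendsto_intros h)
  then have ev: "eventually (\<lambda>\<epsilon>. \<bar>h \<epsilon>\<bar> < a) (at_right 0)"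
    using h0 by (rule order_tendstoD(2))
  define g where "g \<epsilon> = \<psi> (chart x (h \<epsilon>) y + x, chart x (h \<epsilon>) y, p + x - \<epsilon> *\<^sub>R w) * \<eta> (u, w) *
      gap_jac m a (h \<epsilon>)" for \<epsilon>
  have T: "((\<lambda>\<epsilon>. gap_inv m a (h \<epsilon>)) \<longlongrightarrow> gap_inv m a (h 0)) (at_right 0)"
    by (rule isCont_tendsto_compose[OF isCont_gap_inv[OF a h0 m] h])
  have J: "((\<lambda>\<epsilon>. gap_jac m a (h \<epsilon>)) \<longlongrightarrow> gap_jac m a (h 0)) (at_right 0)"
    by (rule isCont_tendsto_compose[OF isCont_gap_jac[OF a h0 m] h])
  have q: "((\<lambda>\<epsilon>. chart x (h \<epsilon>) y) \<longlongrightarrow> chart x (h 0) y) (at_right 0)"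
    using bounded_linear.tendsto[OF bounded_linear_coord[of x] tendsto_Pair[OF tendsto_const[of y] T]]
    by (simp add: chart_def m_def a_def)
  have "isCont \<psi> z" for z
    using \<psi> continuous_on_eq_continuous_at[OF open_UNIV] unfolding test_fun_def by blast
  then have "((\<lambda>\<epsilon>. \<psi> (chart x (h \<epsilon>) y + x, chart x (h \<epsilon>) y, p + x - \<epsilon> *\<^sub>R w)) \<longlongrightarrow>
      \<psi> (chart x (h 0) y + x, chart x (h 0) y, p + x - 0 *\<^sub>R w)) (at_right 0)"
    by (rule isCont_tendsto_compose) (intro tendsto_intros q)
  then have lim: "(g \<longlongrightarrow> g 0) (at_right 0)"
    unfolding g_def by (intro tendsto_intros J)
  have eq: "smeared p \<psi> \<eta> \<epsilon> ((x, y), (u, w)) = g \<epsilon>" if "\<bar>h \<epsilon>\<bar> < a" for \<epsilon>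
    using that by (simp add: smeared_def g_def h_def[symmetric] m_def[symmetric] a_def[symmetric] Let_def)
  have "eventually (\<lambda>\<epsilon>. g \<epsilon> = smeared p \<psi> \<eta> \<epsilon> ((x, y), (u, w))) (at_right 0)"
    using ev by (rule eventually_mono) (simp add: eq)
  from Lim_transform_eventually[OF lim this] show ?thesis
    unfolding eq[OF h0] .
qed

lemma borel_measurable_indicator_comp [measurable (raw)]:
  assumes "f \<in> borel_measurable M" "K \<in> sets borel"
  shows "(\<lambda>z. indicator K (f z) :: ennreal) \<in> borel_measurable M"
  by (rule measurable_compose[OF assms(1) borel_measurable_indicator[OF assms(2)]])

lemma nn_integral_product_indicator_finite:
  fixes A :: "'a::euclidean_space \<Rightarrow> ennreal" and K :: "'b::euclidean_space set" and L :: "'c::euclidean_space set"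
  assumes [measurable]: "A \<in> borel_measurable borel" "K \<in> sets borel" "L \<in> sets borel"
    and K: "emeasure lborel K < \<infinity>" and L: "emeasure lborel L < \<infinity>" and A: "(\<integral>\<^sup>+x. A x \<partial>lborel) < \<infinity>"
  shows "(\<integral>\<^sup>+z. A (fst (fst z)) * indicator K (snd (fst z)) *
    indicator L (snd z) \<partial>lborel) < \<infinity>"
proof -
  have "(\<integral>\<^sup>+z. A (fst (fst z)) * indicator K (snd (fst z)) *
      indicator L (snd z) \<partial>lborel) =
    (\<integral>\<^sup>+z. \<integral>\<^sup>+v. A (fst z) * indicator K (snd z) * indicator L v \<partial>lborel \<partial>lborel)"
    by (subst nn_integral_lborel_pair) ((measurable)[1], simp)
  also have "\<dots> = (\<integral>\<^sup>+z. A (fst z) * indicator K (snd z) * emeasure lborel L \<partial>lborel)"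
    by (intro nn_integral_cong) (simp add: nn_integral_cmult)
  also have "\<dots> = (\<integral>\<^sup>+z. A (fst z) * indicator K (snd z) \<partial>lborel) * emeasure lborel L"
    by (rule nn_integral_multc) measurable
  also have "(\<integral>\<^sup>+z. A (fst z) * indicator K (snd z) \<partial>lborel) =
      (\<integral>\<^sup>+x. \<integral>\<^sup>+y. A x * indicator K y \<partial>lborel \<partial>lborel)"
    by (subst nn_integral_lborel_pair) ((measurable)[1], simp)
  also have "\<dots> = (\<integral>\<^sup>+x. A x * emeasure lborel K \<partial>lborel)"
    by (intro nn_integral_cong) (simp add: nn_integral_cmult)
  also have "\<dots> = (\<integral>\<^sup>+x. A x \<partial>lborel) * emeasure lborel K"
    by (rule nn_integral_multc) measurable
  finally show ?thesis
    using A K L by (simp add: ennreal_mult_less_top)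
qed

text \<open>Where the integrand is nonzero, the support of \<psi> contains the triple, so
  \<open>q'\<close> and \<open>q' + x\<close> have norm at most \<open>R\<close>; hence
  \<open>norm x \<le> 2 * R\<close> and \<open>norm y \<le> R\<close>. The rescaled defect stays in
  the support of \<eta>. None of these bounds involves \<epsilon>.\<close>

lemma smeared_bound:
  assumes \<psi>: "test_fun \<psi>" "\<And>z. 0 \<le> \<psi> z" and \<eta>: "test_fun \<eta>" "\<And>v. 0 \<le> \<eta> v"
  obtains W where "W \<in> borel_measurable borel" "(\<integral>\<^sup>+z. W z \<partial>lborel) < \<infinity>"
    "\<And>\<epsilon> z. ennreal (smeared p \<psi> \<eta> \<epsilon> z) \<le> W z"
proof -
  obtain R where R: "0 < R" "\<And>z. \<psi> z \<noteq> 0 \<Longrightarrow> norm z \<le> R" using test_fun_support[OF \<psi>(1)] by blast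
  obtain S where S: "0 < S" "\<And>v. \<eta> v \<noteq> 0 \<Longrightarrow> norm v \<le> S" using test_fun_support[OF \<eta>(1)] by blast
  obtain M where M: "0 < M" "\<And>z. \<bar>\<psi> z\<bar> \<le> M" using test_fun_bounded[OF \<psi>(1)] by blast
  obtain N where N: "0 < N" "\<And>v. \<bar>\<eta> v\<bar> \<le> N" using test_fun_bounded[OF \<eta>(1)] by blast
  \<comment> \<open>\<open>M\<close> and \<open>N\<close> bound \<psi> and \<eta>. The factor
    \<open>2 * (1 + R) ^ 3\<close> comes from \<open>gap_jac_le\<close> with three energies of size
    at most \<open>1 + R\<close>.\<close>
  define C where "C = M * N * (2 * (1 + R) ^ 3)"
  have C: "0 < C" using M N R by (simp add: C_def)
  define A where "A x = ennreal C * (ennreal (1 / norm x) * indicator (cball 0 (2 * R)) x)" for x :: "real ^ 3"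
  define W where "W = (\<lambda>((x, y), v). A x * indicator (cball 0 R) (y :: real ^ 2) *
      indicator (cball 0 S) (v :: real \<times> (real ^ 3)))"
  have [measurable]: "A \<in> borel_measurable borel" unfolding A_def by measurable
  have "W \<in> borel_measurable borel" unfolding W_def case_prod_unfold by measurable
  moreover have "(\<integral>\<^sup>+z. W z \<partial>lborel) < \<infinity>"
    unfolding W_def case_prod_unfold
  proof (rule nn_integral_product_indicator_finite[OF _ _ _ emeasure_compact_finite emeasure_compact_finite])
    have "(\<integral>\<^sup>+x. A x \<partial>lborel) = ennreal C *
        (\<integral>\<^sup>+(x :: real ^ 3). ennreal (1 / norm x) * indicator (cball 0 (2 * R)) x \<partial>lborel)"
      unfolding A_def by (rule nn_integral_cmult) measurable
    then show "(\<integral>\<^sup>+x. A x \<partial>lborel) < \<infinity>"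
      using nn_integral_inverse_norm_finite[of "2 * R"] by (simp add: ennreal_mult_less_top)
  qed simp_all
  moreover have "ennreal (smeared p \<psi> \<eta> \<epsilon> z) \<le> W z" for \<epsilon> z
  proof -
    obtain x y u w where z: "z = ((x, y), (u, w))" by (metis prod.collapse)
    define h where "h = energy (p + x - \<epsilon> *\<^sub>R w) - energy p + \<epsilon> * u"
    define q where "q = chart x h y"
    define P where "P = \<psi> (q + x, q, p + x - \<epsilon> *\<^sub>R w)"
    define J where "J = gap_jac (1 + (norm y)\<^sup>2) (norm x) h"
    have sm: "smeared p \<psi> \<eta> \<epsilon> z = (if \<bar>h\<bar> < norm x then P * \<eta> (u, w) * J else 0)"
      by (simp add: z smeared_def h_def q_def P_def J_def Let_def)
    show ?thesis
    proof (cases "\<bar>h\<bar> < norm x \<and> P \<noteq> 0 \<and> \<eta> (u, w) \<noteq> 0")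
      case True
      then have h: "\<bar>h\<bar> < norm x" and P: "P \<noteq> 0" and e: "\<eta> (u, w) \<noteq> 0" by auto
      have x: "0 < norm x" using h by linarith
      have n: "norm (q + x, q, p + x - \<epsilon> *\<^sub>R w) \<le> R" using P unfolding P_def by (rule R(2))
      have nq: "norm (q + x) \<le> R" "norm q \<le> R"
        using norm_fst_le[of "q + x" "(q, p + x - \<epsilon> *\<^sub>R w)"] norm_snd_le[of "(q, p + x - \<epsilon> *\<^sub>R w)" "q + x"]
          norm_fst_le[of q "p + x - \<epsilon> *\<^sub>R w"] n by linarith+
      have nx: "norm x \<le> 2 * R"
        using norm_triangle_ineq4[of "q + x" q] nq by simp
      have ny: "norm y \<le> R"
      proof -
        have "(norm y)\<^sup>2 \<le> (norm q)\<^sup>2" by (simp add: q_def chart_def norm_coord)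
        then have "norm y \<le> norm q" by (rule power2_le_imp_le) simp
        then show ?thesis using nq by simp
      qed
      have uw: "norm (u, w) \<le> S" by (rule S(2)[OF e])
      have "J \<le> 2 * (energy q)\<^sup>2 * energy (q + x) / (norm x * (1 + (norm y)\<^sup>2))"
        using gap_jac_le[OF one_plus_norm_sq_pos[of y] x h]
        by (simp add: J_def q_def chart_def energy_coord energy_coord_shift)
      also have "\<dots> \<le> 2 * (energy q)\<^sup>2 * energy (q + x) / norm x"
        using x energy_pos[of "q + x"] one_plus_norm_sq_pos[of y]
        by (intro divide_left_mono mult_pos_pos) auto
      also have "\<dots> \<le> 2 * (1 + R)\<^sup>2 * (1 + R) / norm x"
        using x energy_le[of q] energy_le[of "q + x"] nq energy_pos[of q] energy_pos[of "q + x"]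
        by (intro divide_right_mono mult_mono power_mono) auto
      finally have J: "J \<le> 2 * (1 + R) ^ 3 / norm x"
        by (simp add: power2_eq_square power3_eq_cube)
      have J0: "0 \<le> J" using gap_jac_pos[OF one_plus_norm_sq_pos[of y] x h] by (simp add: J_def)
      have "P * \<eta> (u, w) * J \<le> M * N * (2 * (1 + R) ^ 3 / norm x)"
        using J J0 M(1) M(2)[of "(q + x, q, p + x - \<epsilon> *\<^sub>R w)"] N(1) N(2)[of "(u, w)"] \<psi>(2) \<eta>(2)
        by (intro mult_mono) (auto simp: P_def)
      also have "\<dots> = C * (1 / norm x)" by (simp add: C_def)
      finally have "smeared p \<psi> \<eta> \<epsilon> z \<le> C * (1 / norm x)" using sm h by simp
      then have "ennreal (smeared p \<psi> \<eta> \<epsilon> z) \<le> ennreal C * ennreal (1 / norm x)"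
        using C by (subst ennreal_mult[symmetric]) (auto intro: ennreal_leI)
      also have "\<dots> = W z" using nx ny uw by (simp add: z W_def A_def)
      finally show ?thesis .
    next
      case False
      then have "smeared p \<psi> \<eta> \<epsilon> z = 0" unfolding sm by auto
      then show ?thesis by simp
    qed
  qed
  ultimately show ?thesis using that by blast
qed

text \<open>The factor \<open>\<epsilon> ^ 3\<close> is the Jacobian of
  \<open>p' = p + x - \<epsilon> w\<close>. The variable \<open>t\<close> is moved innermost because
  the gap is substituted for it at fixed \<open>x\<close>, \<open>y\<close> and
  \<open>w\<close>.\<close>

lemma nn_integral_momentum_coordinates:
  fixes F :: "(real ^ 3) \<times> (real ^ 3) \<times> (real ^ 3) \<Rightarrow> ennreal"
  assumes [measurable]: "F \<in> borel_measurable borel" and \<epsilon>: "0 < \<epsilon>"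
  shows "(\<integral>\<^sup>+z. F z \<partial>lborel) = (\<integral>\<^sup>+x. \<integral>\<^sup>+y. \<integral>\<^sup>+w. \<integral>\<^sup>+t. ennreal (\<epsilon> ^ 3) *
    F (coord x y t + x, coord x y t, p + x - \<epsilon> *\<^sub>R w) \<partial>lborel \<partial>lborel \<partial>lborel \<partial>lborel)"
proof -
  have p': "(\<integral>\<^sup>+p'. F (q + x, q, p') \<partial>lborel) =
      (\<integral>\<^sup>+w. ennreal (\<epsilon> ^ 3) * F (q + x, q, p + x - \<epsilon> *\<^sub>R w) \<partial>lborel)" for q x :: "real ^ 3"
    using \<epsilon> by (subst nn_integral_affine[of _ "- \<epsilon>" "p + x"]) (simp_all add: nn_integral_cmult)
  have "(\<integral>\<^sup>+z. F z \<partial>lborel) = (\<integral>\<^sup>+q. \<integral>\<^sup>+q'. \<integral>\<^sup>+p'. F (q, q', p') \<partial>lborel \<partial>lborel \<partial>lborel)"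
    by (simp add: nn_integral_lborel_pair)
  also have "\<dots> = (\<integral>\<^sup>+q'. \<integral>\<^sup>+q. \<integral>\<^sup>+p'. F (q, q', p') \<partial>lborel \<partial>lborel \<partial>lborel)"
    by (rule nn_integral_lborel_swap) measurable
  also have "\<dots> = (\<integral>\<^sup>+q'. \<integral>\<^sup>+x. \<integral>\<^sup>+p'. F (q' + x, q', p') \<partial>lborel \<partial>lborel \<partial>lborel)"
    using nn_integral_affine[of "\<lambda>q. \<integral>\<^sup>+p'. F (q, q', p') \<partial>lborel" 1 q' for q'] by simp
  also have "\<dots> = (\<integral>\<^sup>+q'. \<integral>\<^sup>+x. \<integral>\<^sup>+w. ennreal (\<epsilon> ^ 3) * F (q' + x, q', p + x - \<epsilon> *\<^sub>R w)
      \<partial>lborel \<partial>lborel \<partial>lborel)"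
    unfolding p' ..
  also have "\<dots> = (\<integral>\<^sup>+x. \<integral>\<^sup>+q'. \<integral>\<^sup>+w. ennreal (\<epsilon> ^ 3) * F (q' + x, q', p + x - \<epsilon> *\<^sub>R w)
      \<partial>lborel \<partial>lborel \<partial>lborel)"
    by (rule nn_integral_lborel_swap) measurable
  also have "\<dots> = (\<integral>\<^sup>+x. \<integral>\<^sup>+y. \<integral>\<^sup>+t. \<integral>\<^sup>+w. ennreal (\<epsilon> ^ 3) *
      F (coord x y t + x, coord x y t, p + x - \<epsilon> *\<^sub>R w) \<partial>lborel \<partial>lborel \<partial>lborel \<partial>lborel)"
    by (intro nn_integral_cong nn_integral_coord) measurable
  also have "\<dots> = (\<integral>\<^sup>+x. \<integral>\<^sup>+y. \<integral>\<^sup>+w. \<integral>\<^sup>+t. ennreal (\<epsilon> ^ 3) *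
      F (coord x y t + x, coord x y t, p + x - \<epsilon> *\<^sub>R w) \<partial>lborel \<partial>lborel \<partial>lborel \<partial>lborel)"
    by (intro nn_integral_cong nn_integral_lborel_swap) measurable
  finally show ?thesis .
qed

lemma momentum_defect_coord:
  assumes "0 < \<epsilon>"
  shows "momentum_defect p (coord x y t + x, coord x y t, p + x - \<epsilon> *\<^sub>R w) /\<^sub>R \<epsilon> =
    ((energy_gap (1 + (norm y)\<^sup>2) (norm x) t - (energy (p + x - \<epsilon> *\<^sub>R w) - energy p)) / \<epsilon>, w)"
proof -
  have "p + (coord x y t + x) - (p + x - \<epsilon> *\<^sub>R w) - coord x y t = \<epsilon> *\<^sub>R w" by simp
  then show ?thesis
    using assms
    by (simp add: momentum_defect_def four_mom_def energy_gap_def energy_coord energy_coord_shift)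
      (simp add: divide_inverse algebra_simps)
qed

text \<open>The powers of \<epsilon> cancel exactly: \<open>\<epsilon> ^ 3\<close> comes from
  rescaling the momentum defect and one more factor from \<open>h = c + \<epsilon> u\<close>,
  against the normalization \<open>\<epsilon> ^ 4\<close>.\<close>

lemma nn_integral_smeared:
  assumes \<psi>: "\<psi> \<in> borel_measurable borel" "\<And>z. 0 \<le> \<psi> z"
    and \<eta>: "\<eta> \<in> borel_measurable borel" "\<And>v. 0 \<le> \<eta> v" and \<epsilon>: "0 < \<epsilon>"
  shows "(\<integral>\<^sup>+z. ennreal (\<psi> z * (\<eta> (momentum_defect p z /\<^sub>R \<epsilon>) / \<epsilon> ^ 4)) \<partial>lborel) =
    (\<integral>\<^sup>+z. ennreal (smeared p \<psi> \<eta> \<epsilon> z) \<partial>lborel)"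
proof -
  have [measurable]: "\<psi> \<in> borel_measurable borel" "\<eta> \<in> borel_measurable borel"
    "momentum_defect p \<in> borel_measurable borel" "smeared p \<psi> \<eta> \<epsilon> \<in> borel_measurable borel"
    using \<psi> \<eta> borel_measurable_smeared borel_measurable_continuous_onI[OF continuous_on_momentum_defect] by auto
  define c where "c x w = energy (p + x - \<epsilon> *\<^sub>R w) - energy p" for x w
  have inner: "(\<integral>\<^sup>+t. ennreal (\<epsilon> ^ 3) * ennreal (\<psi> (coord x y t + x, coord x y t, p + x - \<epsilon> *\<^sub>R w) *
        (\<eta> (momentum_defect p (coord x y t + x, coord x y t, p + x - \<epsilon> *\<^sub>R w) /\<^sub>R \<epsilon>) / \<epsilon> ^ 4)) \<partial>lborel) =
      (\<integral>\<^sup>+u. ennreal (smeared p \<psi> \<eta> \<epsilon> ((x, y), (u, w))) \<partial>lborel)" if x: "x \<noteq> 0" for x y w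
  proof -
    let ?m = "1 + (norm y)\<^sup>2" and ?a = "norm x"
    define G where "G t h = \<psi> (coord x y t + x, coord x y t, p + x - \<epsilon> *\<^sub>R w) * \<eta> ((h - c x w) / \<epsilon>, w) / \<epsilon>" for t h
    have G: "case_prod G \<in> borel_measurable borel"
      unfolding G_def case_prod_unfold by measurable
    have G': "(\<lambda>h. ennreal (G (gap_inv ?m ?a h) h * gap_jac ?m ?a h) * indicator {- ?a<..<?a} h) \<in> borel_measurable borel"
      unfolding G_def by measurable
    have G0: "0 \<le> G t h" for t h using \<psi> \<eta> \<epsilon> by (simp add: G_def)
    have "(\<integral>\<^sup>+t. ennreal (\<epsilon> ^ 3) * ennreal (\<psi> (coord x y t + x, coord x y t, p + x - \<epsilon> *\<^sub>R w) *
        (\<eta> (momentum_defect p (coord x y t + x, coord x y t, p + x - \<epsilon> *\<^sub>R w) /\<^sub>R \<epsilon>) / \<epsilon> ^ 4)) \<partial>lborel) =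
      (\<integral>\<^sup>+t. ennreal (G t (energy_gap ?m ?a t)) \<partial>lborel)"
    proof (rule nn_integral_cong)
      fix t
      have "\<epsilon> ^ 3 * (P * (E / \<epsilon> ^ 4)) = P * E / \<epsilon>" for P E :: real
        using \<epsilon> by (simp add: power_eq_if)
      then show "ennreal (\<epsilon> ^ 3) * ennreal (\<psi> (coord x y t + x, coord x y t, p + x - \<epsilon> *\<^sub>R w) *
          (\<eta> (momentum_defect p (coord x y t + x, coord x y t, p + x - \<epsilon> *\<^sub>R w) /\<^sub>R \<epsilon>) / \<epsilon> ^ 4)) =
        ennreal (G t (energy_gap ?m ?a t))"
        unfolding momentum_defect_coord[OF \<epsilon>] G_def c_def
        using \<epsilon> by (subst ennreal_mult'[symmetric]) simp_all
    qed
    also have "\<dots> = (\<integral>\<^sup>+h. ennreal (G (gap_inv ?m ?a h) h * gap_jac ?m ?a h) * indicator {- ?a<..<?a} h \<partial>lborel)"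
      using x by (intro nn_integral_energy_gap one_plus_norm_sq_pos G G0) simp
    also have "\<dots> = ennreal \<epsilon> * (\<integral>\<^sup>+u. ennreal (G (gap_inv ?m ?a (c x w + \<epsilon> * u)) (c x w + \<epsilon> * u) *
        gap_jac ?m ?a (c x w + \<epsilon> * u)) * indicator {- ?a<..<?a} (c x w + \<epsilon> * u) \<partial>lborel)"
      using \<epsilon> by (subst nn_integral_real_affine[OF G', of \<epsilon> "c x w"]) simp_all
    also have "\<dots> = (\<integral>\<^sup>+u. ennreal \<epsilon> * (ennreal (G (gap_inv ?m ?a (c x w + \<epsilon> * u)) (c x w + \<epsilon> * u) *
        gap_jac ?m ?a (c x w + \<epsilon> * u)) * indicator {- ?a<..<?a} (c x w + \<epsilon> * u)) \<partial>lborel)"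
      unfolding G_def by (subst nn_integral_cmult) simp_all
    also have "\<dots> = (\<integral>\<^sup>+u. ennreal (smeared p \<psi> \<eta> \<epsilon> ((x, y), (u, w))) \<partial>lborel)"
    proof (rule nn_integral_cong)
      fix u
      define h where "h = c x w + \<epsilon> * u"
      have u: "(h - c x w) / \<epsilon> = u" using \<epsilon> by (simp add: h_def)
      have sm: "smeared p \<psi> \<eta> \<epsilon> ((x, y), (u, w)) = (if \<bar>h\<bar> < norm x
          then \<psi> (chart x h y + x, chart x h y, p + x - \<epsilon> *\<^sub>R w) * \<eta> (u, w) * gap_jac ?m ?a h else 0)"
        by (simp add: smeared_def h_def c_def Let_def)
      show "ennreal \<epsilon> * (ennreal (G (gap_inv ?m ?a (c x w + \<epsilon> * u)) (c x w + \<epsilon> * u) *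
          gap_jac ?m ?a (c x w + \<epsilon> * u)) * indicator {- ?a<..<?a} (c x w + \<epsilon> * u)) =
        ennreal (smeared p \<psi> \<eta> \<epsilon> ((x, y), (u, w)))"
      proof (cases "\<bar>h\<bar> < norm x")
        case True
        then have "h \<in> {- ?a<..<?a}" by (auto simp: abs_less_iff)
        then show ?thesis
          unfolding h_def[symmetric] sm using True \<epsilon>
          by (simp add: G_def u chart_def flip: ennreal_mult')
      next
        case False
        then have "h \<notin> {- ?a<..<?a}" by (auto simp: abs_less_iff)
        then show ?thesis unfolding h_def[symmetric] sm using False by simp
      qed
    qed
    finally show ?thesis .
  qed
  have "(\<integral>\<^sup>+z. ennreal (\<psi> z * (\<eta> (momentum_defect p z /\<^sub>R \<epsilon>) / \<epsilon> ^ 4)) \<partial>lborel) =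
    (\<integral>\<^sup>+x. \<integral>\<^sup>+y. \<integral>\<^sup>+w. \<integral>\<^sup>+t. ennreal (\<epsilon> ^ 3) *
      ennreal (\<psi> (coord x y t + x, coord x y t, p + x - \<epsilon> *\<^sub>R w) *
        (\<eta> (momentum_defect p (coord x y t + x, coord x y t, p + x - \<epsilon> *\<^sub>R w) /\<^sub>R \<epsilon>) / \<epsilon> ^ 4))
      \<partial>lborel \<partial>lborel \<partial>lborel \<partial>lborel)"
    by (rule nn_integral_momentum_coordinates[OF _ \<epsilon>]) measurable
  also have "\<dots> = (\<integral>\<^sup>+x. \<integral>\<^sup>+y. \<integral>\<^sup>+w. \<integral>\<^sup>+u. ennreal (smeared p \<psi> \<eta> \<epsilon> ((x, y), (u, w)))
      \<partial>lborel \<partial>lborel \<partial>lborel \<partial>lborel)"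
    by (rule nn_integral_cong_AE, rule eventually_mono[OF AE_lborel_singleton[of 0]]) (simp only: inner not_False_eq_True)
  also have "\<dots> = (\<integral>\<^sup>+x. \<integral>\<^sup>+y. \<integral>\<^sup>+u. \<integral>\<^sup>+w. ennreal (smeared p \<psi> \<eta> \<epsilon> ((x, y), (u, w)))
      \<partial>lborel \<partial>lborel \<partial>lborel \<partial>lborel)"
    by (intro nn_integral_cong nn_integral_lborel_swap) measurable
  also have "\<dots> = (\<integral>\<^sup>+z. ennreal (smeared p \<psi> \<eta> \<epsilon> z) \<partial>lborel)"
    by (simp add: nn_integral_lborel_pair)
  finally show ?thesis .
qed

text \<open>At \<epsilon> = 0 neither the level nor \<open>p'\<close> depends on
  \<open>(u, w)\<close>, so \<eta> factors out and integrates to 1.\<close>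

lemma nn_integral_smeared_0:
  assumes \<psi>: "\<psi> \<in> borel_measurable borel" "\<And>z. 0 \<le> \<psi> z" and \<eta>: "mollifier \<eta>"
  shows "(\<integral>\<^sup>+z. ennreal (smeared p \<psi> \<eta> 0 z) \<partial>lborel) = (\<integral>\<^sup>+z. ennreal (\<psi> z) \<partial>collision_measure p)"
proof -
  have e: "test_fun \<eta>" "\<And>v. 0 \<le> \<eta> v" "(\<integral>v. \<eta> v \<partial>lborel) = 1" using \<eta> by (auto simp: mollifier_def)
  have [measurable]: "\<psi> \<in> borel_measurable borel" "\<eta> \<in> borel_measurable borel"
    "smeared p \<psi> \<eta> 0 \<in> borel_measurable borel"
    using \<psi> test_fun_borel_measurable[OF e(1)] borel_measurable_smeared by auto
  have "integrable lborel \<eta>"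
    by (rule test_fun_integrable[OF e(1) _ emeasure_compact_finite]) simp
  then have one: "(\<integral>\<^sup>+v. ennreal (\<eta> v) \<partial>lborel) = 1"
    using e by (simp add: nn_integral_eq_integral)
  define c where "c x = energy (p + x) - energy p" for x
  have "(\<integral>\<^sup>+z. ennreal (smeared p \<psi> \<eta> 0 z) \<partial>lborel) =
      (\<integral>\<^sup>+x. \<integral>\<^sup>+y. \<integral>\<^sup>+v. ennreal (smeared p \<psi> \<eta> 0 ((x, y), v)) \<partial>lborel \<partial>lborel \<partial>lborel)"
    by (subst nn_integral_lborel_pair, simp, subst nn_integral_lborel_pair) simp_all
  also have "\<dots> = (\<integral>\<^sup>+x. \<integral>\<^sup>+y. ennreal (gap_jac (1 + (norm y)\<^sup>2) (norm x) (c x)) *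
      ennreal (\<psi> (chart x (c x) y + x, chart x (c x) y, p + x)) \<partial>lborel \<partial>lborel)"
  proof (rule nn_integral_cong_AE)
    have "(\<integral>\<^sup>+v. ennreal (smeared p \<psi> \<eta> 0 ((x, y), v)) \<partial>lborel) =
        ennreal (gap_jac (1 + (norm y)\<^sup>2) (norm x) (c x)) * ennreal (\<psi> (chart x (c x) y + x, chart x (c x) y, p + x))"
      if x: "x \<noteq> 0" for x y
    proof -
      let ?J = "gap_jac (1 + (norm y)\<^sup>2) (norm x) (c x)" and ?P = "\<psi> (chart x (c x) y + x, chart x (c x) y, p + x)"
      have cx: "\<bar>c x\<bar> < norm x" unfolding c_def by (rule abs_energy_diff_less[OF x])
      have J: "0 \<le> ?J" using gap_jac_pos[OF one_plus_norm_sq_pos[of y] _ cx] x by simp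
      have "ennreal (smeared p \<psi> \<eta> 0 ((x, y), v)) = (ennreal ?J * ennreal ?P) * ennreal (\<eta> v)" for v
        using cx J \<psi>(2) e(2)[of v]
        by (simp add: smeared_def case_prod_unfold Let_def c_def[symmetric] mult_ac flip: ennreal_mult)
      then show ?thesis by (simp add: nn_integral_cmult one)
    qed
    then show "AE x in lborel. (\<integral>\<^sup>+y. \<integral>\<^sup>+v. ennreal (smeared p \<psi> \<eta> 0 ((x, y), v)) \<partial>lborel \<partial>lborel) =
      (\<integral>\<^sup>+y. ennreal (gap_jac (1 + (norm y)\<^sup>2) (norm x) (c x)) *
        ennreal (\<psi> (chart x (c x) y + x, chart x (c x) y, p + x)) \<partial>lborel)"
      using AE_lborel_singleton[of 0] by (auto elim!: eventually_mono)
  qed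
  also have "\<dots> = (\<integral>\<^sup>+z. ennreal (\<psi> z) \<partial>collision_measure p)"
    by (subst nn_integral_collision_measure) (simp_all add: c_def)
  finally show ?thesis .
qed

section \<open>Passage to the limit in the mollified integrals\<close>

lemma tendsto_nn_integral_smeared:
  assumes \<psi>: "test_fun \<psi>" "\<And>z. 0 \<le> \<psi> z" and \<eta>: "mollifier \<eta>"
  shows "((\<lambda>\<epsilon>. \<integral>\<^sup>+z. ennreal (smeared p \<psi> \<eta> \<epsilon> z) \<partial>lborel) \<longlongrightarrow> (\<integral>\<^sup>+z. ennreal (\<psi> z) \<partial>collision_measure p)) (at_right 0)"
    and "(\<integral>\<^sup>+z. ennreal (smeared p \<psi> \<eta> \<epsilon> z) \<partial>lborel) < \<infinity>"
    and "(\<integral>\<^sup>+z. ennreal (\<psi> z) \<partial>collision_measure p) < \<infinity>"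
proof -
  have e: "test_fun \<eta>" "\<And>v. 0 \<le> \<eta> v" using \<eta> by (auto simp: mollifier_def)
  note meas = test_fun_borel_measurable[OF \<psi>(1)] test_fun_borel_measurable[OF e(1)]
  have [measurable]: "smeared p \<psi> \<eta> \<epsilon> \<in> borel_measurable borel" for \<epsilon>
    using borel_measurable_smeared[OF meas] .
  obtain W where W [measurable]: "W \<in> borel_measurable borel" and fin: "(\<integral>\<^sup>+z. W z \<partial>lborel) < \<infinity>"
    and le: "\<And>\<epsilon> z. ennreal (smeared p \<psi> \<eta> \<epsilon> z) \<le> W z"
    using smeared_bound[OF \<psi> e] by blast
  have lt: "(\<integral>\<^sup>+z. ennreal (smeared p \<psi> \<eta> \<epsilon> z) \<partial>lborel) < \<infinity>" for \<epsilon>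
    by (rule le_less_trans[OF nn_integral_mono fin]) (rule le)
  show "(\<integral>\<^sup>+z. ennreal (smeared p \<psi> \<eta> \<epsilon> z) \<partial>lborel) < \<infinity>" by (rule lt)
  show "(\<integral>\<^sup>+z. ennreal (\<psi> z) \<partial>collision_measure p) < \<infinity>"
    using lt[of 0] nn_integral_smeared_0[OF meas(1) \<psi>(2) \<eta>, of p] by simp
  have pt: "((\<lambda>\<epsilon>. smeared p \<psi> \<eta> \<epsilon> z) \<longlongrightarrow> smeared p \<psi> \<eta> 0 z) (at_right 0)" for z
  proof -
    obtain x y u w where z: "z = ((x, y), (u, w))" by (metis prod.collapse)
    show ?thesis
    proof (cases "x = 0")
      case True
      then have "smeared p \<psi> \<eta> \<epsilon> z = 0" for \<epsilon> by (simp add: z smeared_def Let_def)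
      then show ?thesis by simp
    next
      case False
      then show ?thesis unfolding z by (rule smeared_tendsto[OF \<psi>(1)])
    qed
  qed
  have "((\<lambda>\<epsilon>. \<integral>\<^sup>+z. ennreal (smeared p \<psi> \<eta> \<epsilon> z) \<partial>lborel) \<longlongrightarrow> (\<integral>\<^sup>+z. ennreal (smeared p \<psi> \<eta> 0 z) \<partial>lborel)) (at_right 0)"
    \<comment> \<open>Dominated convergence works along sequences, so the one-sided limit is tested
      on arbitrary positive null sequences.\<close>
    unfolding tendsto_at_iff_sequentially comp_def
  proof (intro allI impI)
    fix X :: "nat \<Rightarrow> real" assume X: "\<forall>i. X i \<in> {0<..} - {0}" "X \<longlonglongrightarrow> 0"
    show "(\<lambda>i. \<integral>\<^sup>+z. ennreal (smeared p \<psi> \<eta> (X i) z) \<partial>lborel) \<longlonglongrightarrow> (\<integral>\<^sup>+z. ennreal (smeared p \<psi> \<eta> 0 z) \<partial>lborel)"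
    proof (rule nn_integral_dominated_convergence[where w = W])
      show "AE z in lborel. (\<lambda>i. ennreal (smeared p \<psi> \<eta> (X i) z)) \<longlonglongrightarrow> ennreal (smeared p \<psi> \<eta> 0 z)"
      proof (rule AE_I2)
        fix z
        have "(\<lambda>i. smeared p \<psi> \<eta> (X i) z) \<longlonglongrightarrow> smeared p \<psi> \<eta> 0 z"
          using pt[of z] X unfolding tendsto_at_iff_sequentially comp_def by blast
        then show "(\<lambda>i. ennreal (smeared p \<psi> \<eta> (X i) z)) \<longlonglongrightarrow> ennreal (smeared p \<psi> \<eta> 0 z)"
          by (rule tendsto_ennrealI)
      qed
    qed (use fin le in auto)
  qed
  then show "((\<lambda>\<epsilon>. \<integral>\<^sup>+z. ennreal (smeared p \<psi> \<eta> \<epsilon> z) \<partial>lborel) \<longlongrightarrow> (\<integral>\<^sup>+z. ennreal (\<psi> z) \<partial>collision_measure p)) (at_right 0)"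
    using nn_integral_smeared_0[OF meas(1) \<psi>(2) \<eta>, of p] by simp
qed

lemma sets_collision_measure: "sets (collision_measure p) = sets borel"
  by (simp add: collision_measure_def)

lemma tendsto_mollified_nonneg:
  assumes \<psi>: "test_fun \<psi>" "\<And>z. 0 \<le> \<psi> z" and \<eta>: "mollifier \<eta>"
  shows "((\<lambda>\<epsilon>. \<integral>z. \<psi> z * (\<eta> (momentum_defect p z /\<^sub>R \<epsilon>) / \<epsilon> ^ 4) \<partial>lborel)
      \<longlongrightarrow> (\<integral>z. \<psi> z \<partial>collision_measure p)) (at_right 0)"
    and "0 < \<epsilon> \<Longrightarrow> integrable lborel (\<lambda>z. \<psi> z * (\<eta> (momentum_defect p z /\<^sub>R \<epsilon>) / \<epsilon> ^ 4))"
    and "integrable (collision_measure p) \<psi>"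
proof -
  have e: "test_fun \<eta>" "\<And>v. 0 \<le> \<eta> v" using \<eta> by (auto simp: mollifier_def)
  note meas = test_fun_borel_measurable[OF \<psi>(1)] test_fun_borel_measurable[OF e(1)]
  have [measurable]: "\<psi> \<in> borel_measurable borel" "\<eta> \<in> borel_measurable borel" "momentum_defect p \<in> borel_measurable borel"
    using meas borel_measurable_continuous_onI[OF continuous_on_momentum_defect] by auto
  have [measurable]: "\<psi> \<in> borel_measurable (collision_measure p)"
    using meas(1) sets_collision_measure by (simp cong: measurable_cong_sets)
  note lim = tendsto_nn_integral_smeared[OF \<psi> \<eta>, of p]
  show int: "integrable (collision_measure p) \<psi>"
    using lim(3) \<psi>(2) by (intro integrableI_nonneg) auto
  have sm: "(\<integral>\<^sup>+z. ennreal (\<psi> z * (\<eta> (momentum_defect p z /\<^sub>R \<epsilon>) / \<epsilon> ^ 4)) \<partial>lborel) =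
      (\<integral>\<^sup>+z. ennreal (smeared p \<psi> \<eta> \<epsilon> z) \<partial>lborel)" if "0 < \<epsilon>" for \<epsilon>
    by (rule nn_integral_smeared[OF meas(1) \<psi>(2) meas(2) e(2) that])
  have nonneg: "0 \<le> \<psi> z * (\<eta> (momentum_defect p z /\<^sub>R \<epsilon>) / \<epsilon> ^ 4)" for \<epsilon> z
    using \<psi>(2) e(2) by (intro mult_nonneg_nonneg divide_nonneg_nonneg) auto
  show "integrable lborel (\<lambda>z. \<psi> z * (\<eta> (momentum_defect p z /\<^sub>R \<epsilon>) / \<epsilon> ^ 4))" if "0 < \<epsilon>" for \<epsilon>
    using nonneg[of _ \<epsilon>] sm[OF that] lim(2)[of \<epsilon>] by (intro integrableI_nonneg) auto
  have "(\<integral>\<^sup>+z. ennreal (\<psi> z) \<partial>collision_measure p) = ennreal (\<integral>z. \<psi> z \<partial>collision_measure p)"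
    using int \<psi>(2) by (intro nn_integral_eq_integral) auto
  with lim(1) have "((\<lambda>\<epsilon>. enn2real (\<integral>\<^sup>+z. ennreal (smeared p \<psi> \<eta> \<epsilon> z) \<partial>lborel))
      \<longlongrightarrow> (\<integral>z. \<psi> z \<partial>collision_measure p)) (at_right 0)"
    using \<psi>(2) by (intro tendsto_enn2real) (auto intro: integral_nonneg)
  moreover have "eventually (\<lambda>\<epsilon>. enn2real (\<integral>\<^sup>+z. ennreal (smeared p \<psi> \<eta> \<epsilon> z) \<partial>lborel) =
      (\<integral>z. \<psi> z * (\<eta> (momentum_defect p z /\<^sub>R \<epsilon>) / \<epsilon> ^ 4) \<partial>lborel)) (at_right 0)"
    using eventually_at_right_less[of 0]
  proof (rule eventually_mono)
    fix \<epsilon> :: real assume "0 < \<epsilon>"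
    moreover have "(\<integral>z. \<psi> z * (\<eta> (momentum_defect p z /\<^sub>R \<epsilon>) / \<epsilon> ^ 4) \<partial>lborel) =
        enn2real (\<integral>\<^sup>+z. ennreal (\<psi> z * (\<eta> (momentum_defect p z /\<^sub>R \<epsilon>) / \<epsilon> ^ 4)) \<partial>lborel)"
      by (rule integral_eq_nn_integral) (simp_all add: nonneg[of _ \<epsilon>, simplified])
    ultimately show "enn2real (\<integral>\<^sup>+z. ennreal (smeared p \<psi> \<eta> \<epsilon> z) \<partial>lborel) =
      (\<integral>z. \<psi> z * (\<eta> (momentum_defect p z /\<^sub>R \<epsilon>) / \<epsilon> ^ 4) \<partial>lborel)"
      by (simp only: sm)
  qed
  ultimately show "((\<lambda>\<epsilon>. \<integral>z. \<psi> z * (\<eta> (momentum_defect p z /\<^sub>R \<epsilon>) / \<epsilon> ^ 4) \<partial>lborel)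
      \<longlongrightarrow> (\<integral>z. \<psi> z \<partial>collision_measure p)) (at_right 0)"
    by (rule Lim_transform_eventually)
qed

lemma test_fun_max: "test_fun \<psi> \<Longrightarrow> test_fun (\<lambda>z. max 0 (\<psi> z))"
  unfolding test_fun_def by (auto intro!: continuous_intros elim: bounded_subset)

lemma test_fun_uminus: "test_fun \<psi> \<Longrightarrow> test_fun (\<lambda>z. - \<psi> z)"
  unfolding test_fun_def by (auto intro!: continuous_intros)

theorem dirac_delta_momentum_defect: "dirac_delta (momentum_defect p) = collision_measure p"
proof (rule dirac_delta_eqI, unfold is_dirac_delta_def, intro conjI allI impI)
  show "sets (collision_measure p) = sets borel" by (rule sets_collision_measure)
  obtain \<eta>0 :: "real \<times> (real ^ 3) \<Rightarrow> real" where \<eta>0: "mollifier \<eta>0" using ex_mollifier by blast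
  fix K :: "((real ^ 3) \<times> (real ^ 3) \<times> (real ^ 3)) set" assume K: "compact K"
  then have "bounded K" by (rule compact_imp_bounded)
  then obtain R where R: "\<And>z. z \<in> K \<Longrightarrow> norm z \<le> R"
    unfolding bounded_iff by metis
  \<comment> \<open>The constant \<open>R + 1\<close> makes this cone at least 1 on
    \<open>K\<close>, so its finite integral bounds the measure of \<open>K\<close>.\<close>
  define \<psi> :: "(real ^ 3) \<times> (real ^ 3) \<times> (real ^ 3) \<Rightarrow> real" where "\<psi> z = max 0 (R + 1 - norm z)" for z
  have \<psi>: "test_fun \<psi>"
    unfolding test_fun_def
  proof
    show "continuous_on UNIV \<psi>" unfolding \<psi>_def by (intro continuous_intros)
    show "bounded {z. \<psi> z \<noteq> 0}"
      by (rule bounded_subset[OF bounded_cball[of 0 "R + 1"]]) (auto simp: \<psi>_def max_def split: if_splits)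
  qed
  have "emeasure (collision_measure p) K = (\<integral>\<^sup>+z. indicator K z \<partial>collision_measure p)"
    using K by (simp add: sets_collision_measure borel_compact)
  also have "\<dots> \<le> (\<integral>\<^sup>+z. ennreal (\<psi> z) \<partial>collision_measure p)"
    using R by (intro nn_integral_mono) (force simp: \<psi>_def indicator_def)
  also have "\<dots> < \<infinity>"
    by (rule tendsto_nn_integral_smeared(3)[OF \<psi> _ \<eta>0]) (simp add: \<psi>_def)
  finally show "emeasure (collision_measure p) K < \<infinity>" .
next
  fix \<eta> :: "real \<times> (real ^ 3) \<Rightarrow> real" and \<psi> :: "(real ^ 3) \<times> (real ^ 3) \<times> (real ^ 3) \<Rightarrow> real"
  assume \<eta>: "mollifier \<eta>" and \<psi>: "test_fun \<psi>"
  \<comment> \<open>Test functions may change sign; their positive and negative parts are again test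
    functions, and both limits are finite, so they can be subtracted.\<close>
  define f g where "f z = max 0 (\<psi> z)" and "g z = max 0 (- \<psi> z)" for z
  have f: "test_fun f" "\<And>z. 0 \<le> f z" and g: "test_fun g" "\<And>z. 0 \<le> g z"
    using test_fun_max[OF \<psi>] test_fun_max[OF test_fun_uminus[OF \<psi>]] by (auto simp: f_def[abs_def] g_def[abs_def])
  have fg: "\<psi> z = f z - g z" for z by (simp add: f_def g_def)
  let ?k = "\<lambda>\<epsilon> z. \<eta> (momentum_defect p z /\<^sub>R \<epsilon>) / \<epsilon> ^ 4"
  have "((\<lambda>\<epsilon>. (\<integral>z. f z * ?k \<epsilon> z \<partial>lborel) - (\<integral>z. g z * ?k \<epsilon> z \<partial>lborel))
      \<longlongrightarrow> (\<integral>z. f z \<partial>collision_measure p) - (\<integral>z. g z \<partial>collision_measure p)) (at_right 0)"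
    by (intro tendsto_diff tendsto_mollified_nonneg(1) f g \<eta>)
  moreover have "eventually (\<lambda>\<epsilon>. (\<integral>z. f z * ?k \<epsilon> z \<partial>lborel) - (\<integral>z. g z * ?k \<epsilon> z \<partial>lborel) =
      (\<integral>z. \<psi> z * ?k \<epsilon> z \<partial>lborel)) (at_right 0)"
    using eventually_at_right_less[of 0]
  proof (rule eventually_mono)
    fix \<epsilon> :: real assume \<epsilon>: "0 < \<epsilon>"
    show "(\<integral>z. f z * ?k \<epsilon> z \<partial>lborel) - (\<integral>z. g z * ?k \<epsilon> z \<partial>lborel) = (\<integral>z. \<psi> z * ?k \<epsilon> z \<partial>lborel)"
      unfolding fg left_diff_distrib
      by (rule Bochner_Integration.integral_diff[symmetric])
        (rule tendsto_mollified_nonneg(2)[OF f \<eta> \<epsilon>] tendsto_mollified_nonneg(2)[OF g \<eta> \<epsilon>])+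
  qed
  ultimately have "((\<lambda>\<epsilon>. \<integral>z. \<psi> z * ?k \<epsilon> z \<partial>lborel)
      \<longlongrightarrow> (\<integral>z. f z \<partial>collision_measure p) - (\<integral>z. g z \<partial>collision_measure p)) (at_right 0)"
    by (rule Lim_transform_eventually)
  moreover have "(\<integral>z. f z \<partial>collision_measure p) - (\<integral>z. g z \<partial>collision_measure p) = (\<integral>z. \<psi> z \<partial>collision_measure p)"
    unfolding fg
    by (rule Bochner_Integration.integral_diff[symmetric])
      (rule tendsto_mollified_nonneg(3)[OF f \<eta>] tendsto_mollified_nonneg(3)[OF g \<eta>])+
  ultimately show "((\<lambda>\<epsilon>. \<integral>z. \<psi> z * (\<eta> (momentum_defect p z /\<^sub>R \<epsilon>) / \<epsilon> ^ DIM(real \<times> (real ^ 3))) \<partial>lborel)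
      \<longlongrightarrow> (\<integral>z. \<psi> z \<partial>collision_measure p)) (at_right 0)"
    by simp
qed

section \<open>The Carleman representation\<close>

lemma borel_measurable_arccos [measurable]: "arccos \<in> borel_measurable borel"
proof -
  have "(THE x. 0 \<le> x \<and> x \<le> pi \<and> cos x = y) = (THE x. False)" if "y \<notin> {-1..1}" for y :: real
  proof -
    have "(\<lambda>x. 0 \<le> x \<and> x \<le> pi \<and> cos x = y) = (\<lambda>x. False)"
      using that cos_le_one cos_ge_minus_one by (metis atLeastAtMost_iff)
    then show ?thesis by simp
  qed
  \<comment> \<open>Outside [-1, 1] the description defining \<open>arccos\<close> has no solution
    and always denotes the same unspecified real, so the function is constant there and continuous
    on the closed interval.\<close>
  then have "arccos = (\<lambda>y. if y \<in> {-1..1} then arccos y else (THE x. False))"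
    by (auto simp: arccos_def fun_eq_iff)
  moreover have "(\<lambda>y. if y \<in> {-1..1} then arccos y else (THE x. False)) \<in> borel_measurable borel"
    by (intro borel_measurable_continuous_on_if continuous_on_arccos') auto
  ultimately show ?thesis by simp
qed

lemma borel_measurable_four_mom [measurable]: "four_mom \<in> borel_measurable borel"
  unfolding four_mom_def[abs_def] by measurable

lemma borel_measurable_lorentz [measurable (raw)]:
  assumes [measurable]: "f \<in> borel_measurable M" "g \<in> borel_measurable M"
  shows "(\<lambda>z. lorentz (f z) (g z)) \<in> borel_measurable M"
  unfolding lorentz_def by measurable

lemma borel_measurable_s_inv [measurable (raw)]:
  assumes [measurable]: "f \<in> borel_measurable M" "g \<in> borel_measurable M"
  shows "(\<lambda>z. s_inv (f z) (g z)) \<in> borel_measurable M"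
  unfolding s_inv_def by measurable

lemma borel_measurable_g_inv [measurable (raw)]:
  assumes [measurable]: "f \<in> borel_measurable M" "g \<in> borel_measurable M"
  shows "(\<lambda>z. g_inv (f z) (g z)) \<in> borel_measurable M"
  unfolding g_inv_def by measurable

lemma borel_measurable_scat_angle [measurable (raw)]:
  assumes [measurable]: "f \<in> borel_measurable M" "g \<in> borel_measurable M"
    "h \<in> borel_measurable M" "k \<in> borel_measurable M"
  shows "(\<lambda>z. scat_angle (f z) (g z) (h z) (k z)) \<in> borel_measurable M"
  unfolding scat_angle_def by measurable

lemma borel_measurable_unit_step [measurable]: "unit_step \<in> borel_measurable borel"
  unfolding unit_step_def[abs_def] by measurable

theorem proposition5p1:
  fixes \<sigma> :: "real \<Rightarrow> real \<Rightarrow> real" and f :: "real ^ 3 \<Rightarrow> real" and p :: "real ^ 3"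
  assumes "(\<lambda>(g, \<theta>). \<sigma> g \<theta>) \<in> borel_measurable borel"
    and "\<And>g \<theta>. 0 \<le> \<sigma> g \<theta>"
    and "f \<in> borel_measurable borel"
    and "\<And>x. 0 \<le> f x"
  shows "gain \<sigma> f p =
    ennreal (1 / (2 * energy p)) *
    (\<integral>\<^sup>+ p'. ennreal (1 / energy p' * f p') *
      (\<integral>\<^sup>+ q'.
        (let P = four_mom p; P' = four_mom p'; Q' = four_mom q'; Q = P' + Q' - P in
          ennreal (1 / energy q' *
            (s_inv P Q * \<sigma> (g_inv P Q) (scat_angle P Q P' Q') *
             unit_step (energy p' + energy q' - energy p) * f q' /
             norm (((energy p' - energy p) / energy q') *\<^sub>R q' - (p' - p)))))
        \<partial>surface_measure
            {q'. lorentz (four_mom p' - four_mom p) (four_mom q' - four_mom p) = 0})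
      \<partial>lborel)"
proof -
  note \<sigma> = assms(1) and f = assms(3) and f0 = assms(4)
  have [measurable]: "f \<in> borel_measurable borel" by (rule f)
  have [measurable (raw)]: "(\<lambda>z. \<sigma> (u z) (v z)) \<in> borel_measurable M"
    if [measurable]: "u \<in> borel_measurable M" "v \<in> borel_measurable M" for M :: "'m measure" and u v
    using measurable_compose[OF borel_measurable_Pair[OF that] \<sigma>] by simp
  define F where "F = (\<lambda>(q, q', p').
        ennreal (1 / (energy q * energy q' * energy p') *
          (1 / 2 * s_inv (four_mom p) (four_mom q) *
           \<sigma> (g_inv (four_mom p) (four_mom q))
             (scat_angle (four_mom p) (four_mom q) (four_mom p') (four_mom q')) *
           f p' * f q')))"
  define G where "G p' q' =
        (let P = four_mom p; P' = four_mom p'; Q' = four_mom q'; Q = P' + Q' - P in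
          ennreal (1 / energy q' *
            (s_inv P Q * \<sigma> (g_inv P Q) (scat_angle P Q P' Q') *
             unit_step (energy p' + energy q' - energy p) * f q' /
             norm (((energy p' - energy p) / energy q') *\<^sub>R q' - (p' - p)))))" for p' q'
  have F [measurable]: "F \<in> borel_measurable borel"
    unfolding F_def case_prod_unfold by measurable
  have G: "(\<lambda>z. G (fst z) (snd z)) \<in> borel_measurable borel"
    unfolding G_def Let_def by measurable
  have [measurable (raw)]: "(\<lambda>z. G (u z) (v z)) \<in> borel_measurable M"
    if [measurable]: "u \<in> borel_measurable M" "v \<in> borel_measurable M" for M :: "'m measure" and u v
    using measurable_compose[OF borel_measurable_Pair[OF that] G] by simp
  let ?c = "\<lambda>x. energy (p + x) - energy p"
  let ?q = "\<lambda>x y. chart x (?c x) y"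
  let ?J = "\<lambda>x y. gap_jac (1 + (norm y)\<^sup>2) (norm x) (?c x)"
  let ?A = "\<lambda>x y. norm ((?c x / energy (?q x y)) *\<^sub>R ?q x y - x) * ?J x y / energy (?q x y + x)"
  let ?S = "\<lambda>p'. surface_measure {q'. lorentz (four_mom p' - four_mom p) (four_mom q' - four_mom p) = 0}"
  \<comment> \<open>\<open>H\<close> is the surface integral pulled back to the chart, as a function
    of \<open>x = p' - p\<close>. In this form its measurability in \<open>x\<close> is visible,
    since the chart depends on \<open>x\<close> in a Borel way.\<close>
  define H where "H x = ennreal (1 / energy (p + x) * f (p + x)) *
    (\<integral>\<^sup>+y. ennreal (?A x y) * G (p + x) (?q x y) \<partial>lborel)" for x
  have H [measurable]: "H \<in> borel_measurable borel"
    unfolding H_def by measurable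
  have surface: "ennreal (1 / energy (p + x) * f (p + x)) * (\<integral>\<^sup>+q'. G (p + x) q' \<partial>?S (p + x)) = H x"
    if x: "x \<noteq> 0" for x
    unfolding H_def by (subst nn_integral_collision_surface[OF x]) simp_all
  have pointwise: "ennreal (?J x y) * F (?q x y + x, ?q x y, p + x) =
      ennreal (1 / 2) * (ennreal (1 / energy (p + x) * f (p + x)) * (ennreal (?A x y) * G (p + x) (?q x y)))"
    if x: "x \<noteq> 0" for x y
  proof -
    define q' q N J where "q' = ?q x y" and "q = ?q x y + x"
      and "N = norm ((?c x / energy q') *\<^sub>R q' - x)" and "J = ?J x y"
    have c: "\<bar>?c x\<bar> < norm x" by (rule abs_energy_diff_less[OF x])
    have J: "0 \<le> J" using gap_jac_pos[OF one_plus_norm_sq_pos[of y] _ c] x by (simp add: J_def)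
    have e: "0 < energy q" "0 < energy q'" "0 < energy (p + x)" by (rule energy_pos)+
    \<comment> \<open>Energy conservation on the chart does two things: \<open>P' + Q' - P\<close>
      is the four-momentum of the actual \<open>q\<close>, and the argument of
      \<open>unit_step\<close> is \<open>energy q\<close>, so the step equals 1.\<close>
    have "energy q - energy q' = ?c x"
      using range_chart[OF x c] unfolding q_def q'_def by blast
    then have eq: "energy (p + x) + energy q' - energy p = energy q" by simp
    have Q: "four_mom (p + x) + four_mom q' - four_mom p = four_mom q"
      using eq by (simp add: four_mom_def q_def q'_def)
    \<comment> \<open>Velocities are below 1 and |c| < \<open>norm x\<close>, so the denominator
      \<open>N\<close> is positive and cancels against the same norm in the area element.\<close>
    have "norm ((?c x / energy q') *\<^sub>R q') = \<bar>?c x\<bar> * (norm q' / energy q')"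
      using e by simp
    also have "\<dots> \<le> \<bar>?c x\<bar> * 1"
      using e norm_less_energy[of q'] by (intro mult_left_mono) auto
    also have "\<dots> < norm x" using c by simp
    finally have "norm ((?c x / energy q') *\<^sub>R q') < norm x" .
    then have "(?c x / energy q') *\<^sub>R q' \<noteq> x" by (metis less_irrefl)
    then have N: "0 < N" by (simp add: N_def)
    define X where "X = s_inv (four_mom p) (four_mom q) *
        \<sigma> (g_inv (four_mom p) (four_mom q)) (scat_angle (four_mom p) (four_mom q) (four_mom (p + x)) (four_mom q'))"
    have "ennreal J * F (q, q', p + x) =
        ennreal (J * (1 / (energy q * energy q' * energy (p + x)) * (1 / 2 * X * f (p + x) * f q')))"
      unfolding ennreal_mult'[OF J] F_def X_def prod.case by (simp only: mult.assoc)
    \<comment> \<open>The 1/2 of the kernel is the only constant left over; together with the outer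
      \<open>1 / energy p\<close> it gives the prefactor \<open>1 / (2 * energy p)\<close>.\<close>
    also have "J * (1 / (energy q * energy q' * energy (p + x)) * (1 / 2 * X * f (p + x) * f q')) =
        1 / 2 * ((1 / energy (p + x) * f (p + x)) * (N * J / energy q * (1 / energy q' * (X * 1 * f q' / N))))"
      using e N by (simp add: field_simps)
    \<comment> \<open>The rule \<open>ennreal_mult'\<close> asks for nonnegativity of the left
      factor, so the factors are ordered with the kernel \<open>X\<close> in the last one.\<close>
    also have "ennreal \<dots> = ennreal (1 / 2) * (ennreal (1 / energy (p + x) * f (p + x)) *
        (ennreal (N * J / energy q) * ennreal (1 / energy q' * (X * 1 * f q' / N))))"
      using e N J f0[of "p + x"] by (simp only: ennreal_mult' divide_nonneg_pos mult_nonneg_nonneg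
          less_imp_le zero_le_one zero_less_numeral zero_le_numeral divide_nonneg_nonneg)
    also have "ennreal (1 / energy q' * (X * 1 * f q' / N)) = G (p + x) q'"
      using e by (simp add: G_def Let_def Q eq X_def N_def unit_step_def)
    finally show ?thesis by (simp only: q_def q'_def N_def J_def)
  qed
  have "(\<integral>\<^sup>+z. F z \<partial>dirac_delta (momentum_defect p)) =
      (\<integral>\<^sup>+x. \<integral>\<^sup>+y. ennreal (?J x y) * F (?q x y + x, ?q x y, p + x) \<partial>lborel \<partial>lborel)"
    unfolding dirac_delta_momentum_defect by (rule nn_integral_collision_measure[OF F])
  also have "\<dots> = (\<integral>\<^sup>+x. ennreal (1 / 2) * H x \<partial>lborel)"
  proof (rule nn_integral_cong_AE, rule eventually_mono[OF AE_lborel_singleton[of 0]])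
    fix x :: "real ^ 3" assume x: "x \<noteq> 0"
    have "(\<integral>\<^sup>+y. ennreal (?J x y) * F (?q x y + x, ?q x y, p + x) \<partial>lborel) =
      (\<integral>\<^sup>+y. ennreal (1 / 2) * (ennreal (1 / energy (p + x) * f (p + x)) * (ennreal (?A x y) * G (p + x) (?q x y))) \<partial>lborel)"
      by (simp only: pointwise[OF x])
    also have "\<dots> = ennreal (1 / 2) * H x"
      unfolding H_def by (subst nn_integral_cmult, measurable, subst nn_integral_cmult, measurable)
    finally show "(\<integral>\<^sup>+y. ennreal (?J x y) * F (?q x y + x, ?q x y, p + x) \<partial>lborel) = ennreal (1 / 2) * H x" .
  qed
  also have "\<dots> = ennreal (1 / 2) * (\<integral>\<^sup>+x. H x \<partial>lborel)"
    by (rule nn_integral_cmult) simp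
  also have "(\<integral>\<^sup>+x. H x \<partial>lborel) = (\<integral>\<^sup>+p'. H (p' - p) \<partial>lborel)"
    using nn_integral_affine[of H 1 "- p"] by simp
  also have "\<dots> = (\<integral>\<^sup>+p'. ennreal (1 / energy p' * f p') * (\<integral>\<^sup>+q'. G p' q' \<partial>?S p') \<partial>lborel)"
  \<comment> \<open>At \<open>p' = p\<close> the Lorentz condition is void and the collision set is
    the whole space, outside the reach of the chart; a single point is null for the outer
    integral.\<close>
  proof (rule nn_integral_cong_AE, rule eventually_mono[OF AE_lborel_singleton[of p]])
    fix p' assume "p' \<noteq> p"
    then show "H (p' - p) = ennreal (1 / energy p' * f p') * (\<integral>\<^sup>+q'. G p' q' \<partial>?S p')"
      using surface[of "p' - p"] by simp
  qed
  finally have *: "(\<integral>\<^sup>+z. F z \<partial>dirac_delta (momentum_defect p)) =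
      ennreal (1 / 2) * (\<integral>\<^sup>+p'. ennreal (1 / energy p' * f p') * (\<integral>\<^sup>+q'. G p' q' \<partial>?S p') \<partial>lborel)" .
  have "gain \<sigma> f p = ennreal (1 / energy p) * (\<integral>\<^sup>+z. F z \<partial>dirac_delta (momentum_defect p))"
    by (simp add: gain_def F_def case_prod_unfold)
  also have "\<dots> = ennreal (1 / (2 * energy p)) *
      (\<integral>\<^sup>+p'. ennreal (1 / energy p' * f p') * (\<integral>\<^sup>+q'. G p' q' \<partial>?S p') \<partial>lborel)"
  proof -
    have "1 / (2 * energy p) = 1 / energy p * (1 / 2)" by simp
    then have "ennreal (1 / (2 * energy p)) = ennreal (1 / energy p) * ennreal (1 / 2)"
      using energy_pos[of p] by (simp only: ennreal_mult' divide_nonneg_pos zero_le_one)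
    then show ?thesis unfolding * by (simp only: mult.assoc)
  qed
  finally show ?thesis unfolding G_def .
qed

end
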